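(* Let $d\in\{1,2\}$, let $K$ be any simplicial complex on $[m]$ and let $H_d$ be any closed subgroup of $G_d^m$. Then there is a homotopy equivalence \[ (D^d,S^{d-1})^{K}/H_d\simeq \operatorname{hocolim}_{I\in \mathrm{cat}(K)}\ G_d^m/( G_d^I\cdot H_d), \] where the diagram on the right sends $I$ to $G_d^m/(G_d^I\cdot H_d)$ and an inclusion $I\subseteq J$ to the natural projection $G_d^m/(G_d^I\cdot H_d)\to G_d^m/(G_d^J\cdot H_d)$.
   Context: Let $d\in\{1,2\}$; $G_1=\{\pm1\}\cong\mathbb Z/2\mathbb Z\subset\mathbb R$, $G_2=S^1\subset\mathbb C$; $D^1\subset\mathbb R$, $D^2\subset\mathbb C$ are the closed unit disks and $S^{d-1}=\partial D^d$. $K$ is a simplicial complex on the vertex set $[m]=\{1,\dots,m\}$, and $\mathrm{cat}(K)$ is the poset category whose objects are the faces of $K$ together with the empty set, with arrows the inclusions. For $I\subseteq[m]$, $G_d^I\subseteq G_d^m$ denotes the coordinate subgroup of elements whose coordinates outside $I$ equal $1$ ($G_d^\varnothing=\{1\}$). For $I\subseteq[m]$ let $(D^d,S^{d-1})^I=\prod_{i\in I}D^d\times\prod_{j\notin I}S^{d-1}\subseteq (D^d)^m$, and the (real for $d=1$, complex for $d=2$) moment-angle complex is $(D^d,S^{d-1})^K=\bigcup_{I\in K}(D^d,S^{d-1})^I\subseteq (D^d)^m$, with the coordinatewise action of $G_d^m$ (restricted to the closed subgroup $H_d$). $G_d^I\cdot H_d$ denotes the subgroup of $G_d^m$ generated by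 $G_d^I$ and $H_d$. Homotopy colimits are taken in compactly generated Hausdorff spaces. *)

theory Defs
  imports "HOL-Analysis.Analysis"
begin

definition quotient_topology :: "'a topology \<Rightarrow> ('a \<Rightarrow> 'b) \<Rightarrow> 'b topology" where
  "quotient_topology X q = topology (\<lambda>U. U \<subseteq> q ` topspace X \<and> openin X {x \<in> topspace X. q x \<in> U})"

definition std_simplex :: "nat \<Rightarrow> (nat \<Rightarrow> real) set" where
  "std_simplex n = {t. (\<forall>k. 0 \<le> t k) \<and> (\<forall>k>n. t k = 0) \<and> (\<Sum>k\<le>n. t k) = 1}"

definition simplex_top :: "nat \<Rightarrow> (nat \<Rightarrow> real) topology" where
  "simplex_top n = subtopology euclidean (std_simplex n)"

definition chains :: "'i set set \<Rightarrow> 'i set list set" where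
  "chains P = {\<sigma>. \<sigma> \<noteq> [] \<and> set \<sigma> \<subseteq> P \<and> sorted_wrt (\<subset>) \<sigma>}"

definition bk_total :: "'i set set \<Rightarrow> ('i set \<Rightarrow> 'a topology)
    \<Rightarrow> ('i set list \<times> ('a \<times> (nat \<Rightarrow> real))) topology" where
  "bk_total P F = sum_topology (\<lambda>\<sigma>. prod_topology (F (hd \<sigma>)) (simplex_top (length \<sigma> - 1))) (chains P)"

definition drop_coord :: "nat \<Rightarrow> (nat \<Rightarrow> real) \<Rightarrow> nat \<Rightarrow> real" where
  "drop_coord k t = (\<lambda>j. if j < k then t j else t (Suc j))"

definition del_nth :: "nat \<Rightarrow> 'b list \<Rightarrow> 'b list" where
  "del_nth k xs = take k xs @ drop (Suc k) xs"

text \<open>Elementary face identification: a point with vanishing k-th barycentric coordinate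
  is identified with the corresponding point over the k-th face of the chain; for k = 0
  the point of F(I_0) is pushed forward to F(I_1) along the diagram map.\<close>
definition bk_face :: "('i set \<Rightarrow> 'i set \<Rightarrow> 'a \<Rightarrow> 'a)
    \<Rightarrow> ('i set list \<times> ('a \<times> (nat \<Rightarrow> real)))
    \<Rightarrow> ('i set list \<times> ('a \<times> (nat \<Rightarrow> real))) \<Rightarrow> bool" where
  "bk_face f p q \<longleftrightarrow> (\<exists>\<sigma> x t k. p = (\<sigma>, (x, t)) \<and> 2 \<le> length \<sigma> \<and> k < length \<sigma> \<and> t k = 0 \<and>
      q = (del_nth k \<sigma>, ((if k = 0 then f (\<sigma> ! 0) (\<sigma> ! 1) x else x), drop_coord k t)))"

definition bk_equiv :: "'i set set \<Rightarrow> ('i set \<Rightarrow> 'a topology) \<Rightarrow> ('i set \<Rightarrow> 'i set \<Rightarrow> 'a \<Rightarrow> 'a)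
    \<Rightarrow> ('i set list \<times> ('a \<times> (nat \<Rightarrow> real)))
    \<Rightarrow> ('i set list \<times> ('a \<times> (nat \<Rightarrow> real))) \<Rightarrow> bool" where
  "bk_equiv P F f = (\<lambda>p q. p \<in> topspace (bk_total P F) \<and> q \<in> topspace (bk_total P F) \<and>
      (\<lambda>a b. a \<in> topspace (bk_total P F) \<and> b \<in> topspace (bk_total P F) \<and>
             (bk_face f a b \<or> bk_face f b a))\<^sup>*\<^sup>* p q)"

text \<open>Homotopy colimit of a diagram (F, f) over a poset P of sets ordered by inclusion,
  modelled by the standard Bousfield--Kan construction (geometric realisation of the
  simplicial replacement, using non-degenerate chains).\<close>
definition poset_hocolim :: "'i set set \<Rightarrow> ('i set \<Rightarrow> 'a topology) \<Rightarrow> ('i set \<Rightarrow> 'i set \<Rightarrow> 'a \<Rightarrow> 'a)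
    \<Rightarrow> ('i set list \<times> ('a \<times> (nat \<Rightarrow> real))) set topology" where
  "poset_hocolim P F f = quotient_topology (bk_total P F)
      (\<lambda>p. {q. bk_equiv P F f p q})"

text \<open>Everything is embedded in the complex numbers: for d = 1, G_1 = {1,-1},
  D^1 = [-1,1] (real line), S^0 = {1,-1}; for d = 2, G_2 = S^1, D^2 = closed unit disk.\<close>
definition Gd :: "nat \<Rightarrow> complex set" where
  "Gd d = (if d = 1 then {1, -1} else sphere 0 1)"

definition Dd :: "nat \<Rightarrow> complex set" where
  "Dd d = (if d = 1 then complex_of_real ` {-1..1} else cball 0 1)"

definition Sd :: "nat \<Rightarrow> complex set" where
  "Sd d = (if d = 1 then {1, -1} else sphere 0 1)"

definition cube_top :: "nat \<Rightarrow> (nat \<Rightarrow> complex) topology" where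
  "cube_top m = product_topology (\<lambda>i. euclidean) {1..m}"

definition simplicial_complex_on :: "nat \<Rightarrow> nat set set \<Rightarrow> bool" where
  "simplicial_complex_on m K \<longleftrightarrow> {} \<in> K \<and> (\<forall>I\<in>K. I \<subseteq> {1..m}) \<and> (\<forall>I\<in>K. \<forall>J. J \<subseteq> I \<longrightarrow> J \<in> K)"

definition polyhedral_product_piece :: "nat \<Rightarrow> nat \<Rightarrow> nat set \<Rightarrow> (nat \<Rightarrow> complex) set" where
  "polyhedral_product_piece d m I =
     {z \<in> PiE {1..m} (\<lambda>_. Dd d). (\<forall>i\<in>I. z i \<in> Dd d) \<and> (\<forall>j\<in>{1..m} - I. z j \<in> Sd d)}"

definition moment_angle :: "nat \<Rightarrow> nat \<Rightarrow> nat set set \<Rightarrow> (nat \<Rightarrow> complex) set" where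
  "moment_angle d m K = (\<Union>I\<in>K. polyhedral_product_piece d m I)"

definition Gm :: "nat \<Rightarrow> nat \<Rightarrow> (nat \<Rightarrow> complex) set" where
  "Gm d m = PiE {1..m} (\<lambda>_. Gd d)"

definition gmul :: "nat \<Rightarrow> (nat \<Rightarrow> complex) \<Rightarrow> (nat \<Rightarrow> complex) \<Rightarrow> nat \<Rightarrow> complex" where
  "gmul m g h = (\<lambda>i. if i \<in> {1..m} then g i * h i else undefined)"

definition gone :: "nat \<Rightarrow> nat \<Rightarrow> complex" where
  "gone m = (\<lambda>i. if i \<in> {1..m} then 1 else undefined)"

definition ginv :: "nat \<Rightarrow> (nat \<Rightarrow> complex) \<Rightarrow> nat \<Rightarrow> complex" where
  "ginv m g = (\<lambda>i. if i \<in> {1..m} then inverse (g i) else undefined)"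

definition closed_subgroup :: "nat \<Rightarrow> nat \<Rightarrow> (nat \<Rightarrow> complex) set \<Rightarrow> bool" where
  "closed_subgroup d m H \<longleftrightarrow> H \<subseteq> Gm d m \<and> gone m \<in> H \<and>
     (\<forall>g\<in>H. \<forall>h\<in>H. gmul m g h \<in> H) \<and> (\<forall>g\<in>H. ginv m g \<in> H) \<and>
     closedin (cube_top m) H"

definition coord_subgroup :: "nat \<Rightarrow> nat \<Rightarrow> nat set \<Rightarrow> (nat \<Rightarrow> complex) set" where
  "coord_subgroup d m I = {g \<in> Gm d m. \<forall>j\<in>{1..m} - I. g j = 1}"

text \<open>Subgroup generated by G_d^I and H (G_d^m is abelian, so it is the product set).\<close>
definition join_subgroup :: "nat \<Rightarrow> nat \<Rightarrow> nat set \<Rightarrow> (nat \<Rightarrow> complex) set \<Rightarrow> (nat \<Rightarrow> complex) set" where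
  "join_subgroup d m I H = {gmul m g h | g h. g \<in> coord_subgroup d m I \<and> h \<in> H}"

definition mac_orbit_space :: "nat \<Rightarrow> nat \<Rightarrow> nat set set \<Rightarrow> (nat \<Rightarrow> complex) set
    \<Rightarrow> (nat \<Rightarrow> complex) set topology" where
  "mac_orbit_space d m K H = quotient_topology (subtopology (cube_top m) (moment_angle d m K))
      (\<lambda>z. {gmul m h z | h. h \<in> H})"

definition coset_space :: "nat \<Rightarrow> nat \<Rightarrow> (nat \<Rightarrow> complex) set \<Rightarrow> (nat \<Rightarrow> complex) set topology" where
  "coset_space d m L = quotient_topology (subtopology (cube_top m) (Gm d m))
      (\<lambda>g. {gmul m g l | l. l \<in> L})"

definition tq_diagram :: "nat \<Rightarrow> nat \<Rightarrow> (nat \<Rightarrow> complex) set \<Rightarrow> nat set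
    \<Rightarrow> (nat \<Rightarrow> complex) set topology" where
  "tq_diagram d m H I = coset_space d m (join_subgroup d m I H)"

definition tq_proj :: "nat \<Rightarrow> nat \<Rightarrow> (nat \<Rightarrow> complex) set \<Rightarrow> nat set \<Rightarrow> nat set
    \<Rightarrow> (nat \<Rightarrow> complex) set \<Rightarrow> (nat \<Rightarrow> complex) set" where
  "tq_proj d m H I J c = {gmul m g l | g l. g \<in> c \<and> l \<in> join_subgroup d m J H}"

end

theory Submission
  imports Defs
begin

text \<open>The two spaces are in fact homeomorphic. In polar coordinates a point of the polydisk is a
  pair of some g in the group and radii r in the cube, and the stabiliser of r is the coordinate subgroup
  of the vanishing radii. The Kuhn triangulation of the cube, whose simplices are the chains
  of subsets of [m] (the subset I being the vertex with radius 0 on I and 1 off I), identifies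
  the realisation of K with the radii occurring in the moment-angle complex. Sending the class of g over
  a point t of the simplex of a chain to the H-orbit of g r(t) is therefore well defined on the
  homotopy colimit and bijective; it is a homeomorphism since its source is compact and its
  target Hausdorff.\<close>

subsection \<open>Quotient and sum topologies\<close>

text \<open>The delicate point is injectivity: the relation on the Bousfield-Kan model is only
  generated by face identifications, so equivalent points may be joined by a long zigzag. Every
  point is therefore reduced to one with strictly positive weights. From the orbit of such a point
  everything can be read off: the norms give the radii, the radii give the chain and the weights,
  and the freedom left in the group element is exactly that of a coset. No inverse map is written
  down; the orbit space and the homotopy colimit are compared as quotients of one space by the same
  relation. The orientation of the vertices fits the diagram. For positive weights the least member
  of a chain is the zero set of the radius, so the coset space that the model places over the chain
  is the right fibre; the greatest member contains all coordinates of norm below 1, which is what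
  \<open>K\<close> has to control.\<close>

lemma openin_quotient_topology:
  "openin (quotient_topology X q) U \<longleftrightarrow>
     U \<subseteq> q ` topspace X \<and> openin X {x \<in> topspace X. q x \<in> U}"
proof -
  have "istopology (\<lambda>U. U \<subseteq> q ` topspace X \<and> openin X {x \<in> topspace X. q x \<in> U})"
    unfolding istopology_def
  proof (intro conjI allI impI)
    fix S T
    assume S: "S \<subseteq> q ` topspace X \<and> openin X {x \<in> topspace X. q x \<in> S}"
      and T: "T \<subseteq> q ` topspace X \<and> openin X {x \<in> topspace X. q x \<in> T}"
    have "{x \<in> topspace X. q x \<in> S \<inter> T} =
        {x \<in> topspace X. q x \<in> S} \<inter> {x \<in> topspace X. q x \<in> T}" by blast
    with S T show "openin X {x \<in> topspace X. q x \<in> S \<inter> T}" by auto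
    show "S \<inter> T \<subseteq> q ` topspace X" using S by blast
  next
    fix \<K>
    assume K: "\<forall>U\<in>\<K>. U \<subseteq> q ` topspace X \<and> openin X {x \<in> topspace X. q x \<in> U}"
    have "{x \<in> topspace X. q x \<in> \<Union>\<K>} = (\<Union>U\<in>\<K>. {x \<in> topspace X. q x \<in> U})" by blast
    with K show "openin X {x \<in> topspace X. q x \<in> \<Union>\<K>}" by auto
    show "\<Union>\<K> \<subseteq> q ` topspace X" using K by blast
  qed
  then show ?thesis
    by (simp add: quotient_topology_def)
qed

lemma topspace_quotient_topology [simp]: "topspace (quotient_topology X q) = q ` topspace X"
proof
  show "topspace (quotient_topology X q) \<subseteq> q ` topspace X"
    by (meson openin_quotient_topology openin_topspace)
  have "{x \<in> topspace X. q x \<in> q ` topspace X} = topspace X" by blast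
  then have "openin (quotient_topology X q) (q ` topspace X)"
    by (simp add: openin_quotient_topology)
  then show "q ` topspace X \<subseteq> topspace (quotient_topology X q)"
    by (rule openin_subset)
qed

lemma quotient_map_quotient_topology: "quotient_map X (quotient_topology X q) q"
  by (auto simp: quotient_map_def openin_quotient_topology)

lemma closedin_quotient_topology:
  "closedin (quotient_topology X q) U \<longleftrightarrow>
     U \<subseteq> q ` topspace X \<and> closedin X {x \<in> topspace X. q x \<in> U}"
proof -
  have "topspace X - {x \<in> topspace X. q x \<in> U} = {x \<in> topspace X. q x \<in> q ` topspace X - U}"
    by blast
  then show ?thesis
    by (auto simp: closedin_def openin_quotient_topology)
qed

text \<open>Each map factors through the other by the universal property, and the two factors are
  mutually inverse because every point of \<open>Y\<close> and of \<open>Z\<close> comes from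
  \<open>X\<close>. Applied to \<open>collapse\<close> and the class map, this stands in for an
  explicit inverse.\<close>

lemma quotient_maps_same_fibres_imp_homeomorphic_space:
  assumes f: "quotient_map X Y f" and g: "quotient_map X Z g"
    and eq: "\<And>x y. x \<in> topspace X \<Longrightarrow> y \<in> topspace X \<Longrightarrow> f x = f y \<longleftrightarrow> g x = g y"
  shows "Y homeomorphic_space Z"
proof -
  obtain h where h: "continuous_map Y Z h" "\<And>x. x \<in> topspace X \<Longrightarrow> h (f x) = g x"
    using quotient_map_lift_exists[OF f quotient_imp_continuous_map[OF g]] eq by metis
  obtain k where k: "continuous_map Z Y k" "\<And>x. x \<in> topspace X \<Longrightarrow> k (g x) = f x"
    using quotient_map_lift_exists[OF g quotient_imp_continuous_map[OF f]] eq by metis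
  have "homeomorphic_maps Y Z h k"
    unfolding homeomorphic_maps_def
    using h k quotient_imp_surjective_map[OF f, symmetric] quotient_imp_surjective_map[OF g, symmetric]
    by auto
  then show ?thesis
    by (auto simp: homeomorphic_space_def)
qed

lemma continuous_map_from_sum_topology:
  assumes "\<And>i. i \<in> I \<Longrightarrow> continuous_map (X i) Y (\<lambda>x. f (i, x))"
  shows "continuous_map (sum_topology X I) Y f"
proof -
  have "openin (sum_topology X I) {p \<in> Sigma I (topspace \<circ> X). f p \<in> U}" if "openin Y U" for U
    unfolding openin_sum_topology
  proof (intro conjI ballI)
    fix i assume i: "i \<in> I"
    have "{x. (i, x) \<in> {p \<in> Sigma I (topspace \<circ> X). f p \<in> U}} = {x \<in> topspace (X i). f (i, x) \<in> U}"
      using i by auto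
    then show "openin (X i) {x. (i, x) \<in> {p \<in> Sigma I (topspace \<circ> X). f p \<in> U}}"
      using openin_continuous_map_preimage[OF assms[OF i] that] by simp
  qed auto
  moreover have "f p \<in> topspace Y" if "p \<in> Sigma I (topspace \<circ> X)" for p
    using that assms by (force simp: continuous_map_def)
  ultimately show ?thesis
    by (auto simp: continuous_map_def)
qed

lemma compact_space_sum_topology:
  assumes "finite I" "\<And>i. i \<in> I \<Longrightarrow> compact_space (X i)"
  shows "compact_space (sum_topology X I)"
proof -
  have "compactin (sum_topology X I) (\<Union>i\<in>I. Pair i ` topspace (X i))"
    using assms by (intro compactin_Union)
      (auto intro!: image_compactin[OF _ continuous_map_component_injection] simp: compact_space_def)
  moreover have "(\<Union>i\<in>I. Pair i ` topspace (X i)) = topspace (sum_topology X I)"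
    by auto
  ultimately show ?thesis
    by (simp add: compact_space_def)
qed

subsection \<open>The torus action on the moment-angle complex\<close>

lemma Gd_closure:
  "1 \<in> Gd d" "u \<in> Gd d \<Longrightarrow> v \<in> Gd d \<Longrightarrow> u * v \<in> Gd d"
  "u \<in> Gd d \<Longrightarrow> inverse u \<in> Gd d" "u \<in> Gd d \<Longrightarrow> norm u = 1"
  by (auto simp: Gd_def norm_mult norm_inverse split: if_splits)

lemma compact_Gd: "compact (Gd d)"
  by (auto simp: Gd_def)

lemma compact_Dd: "compact (Dd d)"
  by (auto simp: Dd_def intro!: compact_continuous_image continuous_intros)

lemma Dd_norm_le_1: "z \<in> Dd d \<Longrightarrow> norm z \<le> 1"
  by (auto simp: Dd_def split: if_splits)

lemma Sd_iff_norm: "z \<in> Dd d \<Longrightarrow> z \<in> Sd d \<longleftrightarrow> norm z = 1"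
  by (auto simp: Dd_def Sd_def abs_if split: if_splits)

lemma Dd_mult_Gd: "u \<in> Gd d \<Longrightarrow> z \<in> Dd d \<Longrightarrow> u * z \<in> Dd d"
  by (auto simp: Dd_def Gd_def norm_mult image_iff abs_le_iff split: if_splits)

lemma of_real_in_Dd: "0 \<le> r \<Longrightarrow> r \<le> 1 \<Longrightarrow> of_real r \<in> Dd d"
  by (auto simp: Dd_def)

text \<open>The factor is \<open>sgn z\<close>, which for real \<open>z\<close> is a sign and so
  lies in the group also for \<open>d = 1\<close>. At \<open>z = 0\<close> any group element would
  do; this ambiguity is what the coordinate subgroups account for.\<close>

lemma Dd_polar:
  assumes "z \<in> Dd d"
  obtains u where "u \<in> Gd d" "z = u * of_real (norm z)"
proof (cases "z = 0")
  case True
  then show ?thesis using that Gd_closure(1) by auto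
next
  case False
  have "sgn z \<in> Gd d"
    using assms False by (auto simp: Dd_def Gd_def norm_sgn sgn_of_real sgn_if split: if_splits)
  moreover have "z = sgn z * of_real (norm z)"
    using False by (simp add: sgn_eq)
  ultimately show ?thesis using that by blast
qed

section \<open>Coordinatewise multiplication, subgroups and orbits\<close>

lemma gmul_assoc: "gmul m (gmul m a b) c = gmul m a (gmul m b c)"
  by (auto simp: gmul_def fun_eq_iff)

lemma gmul_commute: "gmul m a b = gmul m b a"
  by (auto simp: gmul_def fun_eq_iff)

lemma gmul_left_commute: "gmul m a (gmul m b c) = gmul m b (gmul m a c)"
  by (auto simp: gmul_def fun_eq_iff)

lemmas gmul_ac = gmul_assoc gmul_commute gmul_left_commute

lemma gmul_gone: "z \<in> extensional {1..m} \<Longrightarrow> gmul m (gone m) z = z"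
  by (auto simp: gmul_def gone_def fun_eq_iff extensional_def)

lemma Gm_nonzero: "g \<in> Gm d m \<Longrightarrow> i \<in> {1..m} \<Longrightarrow> g i \<noteq> 0"
  using Gd_closure(4)[of "g i" d] by (auto simp: Gm_def PiE_iff)

lemma gmul_ginv: "g \<in> Gm d m \<Longrightarrow> gmul m (ginv m g) g = gone m"
  using Gm_nonzero by (auto simp: gmul_def gone_def ginv_def fun_eq_iff)

lemma gmul_ginv_cancel:
  "g \<in> Gm d m \<Longrightarrow> z \<in> extensional {1..m} \<Longrightarrow> gmul m (ginv m g) (gmul m g z) = z"
  by (metis gmul_assoc gmul_ginv gmul_gone)

lemma Gm_closure:
  "gone m \<in> Gm d m" "g \<in> Gm d m \<Longrightarrow> h \<in> Gm d m \<Longrightarrow> gmul m g h \<in> Gm d m"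
  "g \<in> Gm d m \<Longrightarrow> ginv m g \<in> Gm d m"
  by (auto simp: Gm_def gone_def gmul_def ginv_def PiE_iff extensional_def intro: Gd_closure)

lemma Gm_extensional: "g \<in> Gm d m \<Longrightarrow> g \<in> extensional {1..m}"
  by (auto simp: Gm_def PiE_def)

text \<open>The algebraic half of \<open>closed_subgroup\<close>, split off so that one orbit
  calculus serves both \<open>H\<close> and the subgroups
  \<open>join_subgroup d m I H\<close>.\<close>

definition subgroup_of_Gm :: "nat \<Rightarrow> nat \<Rightarrow> (nat \<Rightarrow> complex) set \<Rightarrow> bool" where
  "subgroup_of_Gm d m L \<longleftrightarrow> L \<subseteq> Gm d m \<and> gone m \<in> L \<and>
     (\<forall>g\<in>L. \<forall>h\<in>L. gmul m g h \<in> L) \<and> (\<forall>g\<in>L. ginv m g \<in> L)"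

lemma closed_subgroup_imp_subgroup: "closed_subgroup d m H \<Longrightarrow> subgroup_of_Gm d m H"
  by (auto simp: closed_subgroup_def subgroup_of_Gm_def)

text \<open>The points are only asked to be extensional, so the criterion compares
  \<open>H\<close>-orbits in the polydisk as well as, after commuting the factors, cosets in the
  group.\<close>

lemma orbit_eq_iff:
  assumes L: "subgroup_of_Gm d m L" and x: "x \<in> extensional {1..m}" and y: "y \<in> extensional {1..m}"
  shows "{gmul m h x |h. h \<in> L} = {gmul m h y |h. h \<in> L} \<longleftrightarrow> (\<exists>h\<in>L. y = gmul m h x)"
proof
  assume eq: "{gmul m h x |h. h \<in> L} = {gmul m h y |h. h \<in> L}"
  have "y = gmul m (gone m) y" by (rule gmul_gone[OF y, symmetric])
  then have "y \<in> {gmul m h y |h. h \<in> L}" using L by (auto simp: subgroup_of_Gm_def)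
  with eq show "\<exists>h\<in>L. y = gmul m h x" by blast
next
  assume "\<exists>h\<in>L. y = gmul m h x"
  then obtain h where h: "h \<in> L" "y = gmul m h x" by blast
  then have x': "x = gmul m (ginv m h) y"
    using L x by (metis gmul_ginv_cancel subgroup_of_Gm_def subsetD)
  show "{gmul m h x |h. h \<in> L} = {gmul m h y |h. h \<in> L}"
  proof (intro equalityI subsetI)
    fix w assume "w \<in> {gmul m h x |h. h \<in> L}"
    then obtain k where k: "k \<in> L" "w = gmul m k x" by blast
    then have "w = gmul m (gmul m k (ginv m h)) y"
      using x' by (metis gmul_assoc)
    moreover have "gmul m k (ginv m h) \<in> L"
      using k(1) h(1) L by (simp add: subgroup_of_Gm_def)
    ultimately show "w \<in> {gmul m h y |h. h \<in> L}" by blast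
  next
    fix w assume "w \<in> {gmul m h y |h. h \<in> L}"
    then obtain k where "k \<in> L" "w = gmul m k y" by blast
    then have "w = gmul m (gmul m k h) x" "gmul m k h \<in> L"
      using h L by (auto simp: gmul_assoc subgroup_of_Gm_def)
    then show "w \<in> {gmul m h x |h. h \<in> L}" by blast
  qed
qed

text \<open>Commutativity is what makes the product set a subgroup: a product of two elements
  regroups into its coordinate part and its \<open>H\<close> part, and so does an inverse.\<close>

lemma subgroup_join_subgroup:
  assumes "subgroup_of_Gm d m H"
  shows "subgroup_of_Gm d m (join_subgroup d m I H)"
proof -
  have *: "gone m i = 1" "gmul m a b i = a i * b i" "ginv m a i = inverse (a i)"
    if "i \<in> {1..m}" for i a b
    using that by (auto simp: gone_def gmul_def ginv_def)
  have C: "gone m \<in> coord_subgroup d m I"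
    "\<And>a b. a \<in> coord_subgroup d m I \<Longrightarrow> b \<in> coord_subgroup d m I \<Longrightarrow> gmul m a b \<in> coord_subgroup d m I"
    "\<And>a. a \<in> coord_subgroup d m I \<Longrightarrow> ginv m a \<in> coord_subgroup d m I"
    "coord_subgroup d m I \<subseteq> Gm d m"
    unfolding coord_subgroup_def by (auto intro: Gm_closure simp: * simp del: One_nat_def)
  have H: "H \<subseteq> Gm d m" "gone m \<in> H" "\<And>a b. a \<in> H \<Longrightarrow> b \<in> H \<Longrightarrow> gmul m a b \<in> H"
    "\<And>a. a \<in> H \<Longrightarrow> ginv m a \<in> H"
    using assms by (auto simp: subgroup_of_Gm_def)
  show ?thesis
    unfolding subgroup_of_Gm_def join_subgroup_def
  proof (intro conjI ballI)
    show "{gmul m g h |g h. g \<in> coord_subgroup d m I \<and> h \<in> H} \<subseteq> Gm d m"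
      using C(4) H(1) by (auto intro!: Gm_closure(2))
    have "gone m = gmul m (gone m) (gone m)"
      by (rule gmul_gone[OF Gm_extensional[OF Gm_closure(1)], symmetric])
    then show "gone m \<in> {gmul m g h |g h. g \<in> coord_subgroup d m I \<and> h \<in> H}"
      using C H by blast
  next
    fix x y assume "x \<in> {gmul m g h |g h. g \<in> coord_subgroup d m I \<and> h \<in> H}"
      "y \<in> {gmul m g h |g h. g \<in> coord_subgroup d m I \<and> h \<in> H}"
    then obtain a b a' b' where "x = gmul m a b" "y = gmul m a' b'"
      "a \<in> coord_subgroup d m I" "a' \<in> coord_subgroup d m I" "b \<in> H" "b' \<in> H" by blast
    moreover from this have "gmul m x y = gmul m (gmul m a a') (gmul m b b')"
      by (simp add: gmul_ac)
    ultimately show "gmul m x y \<in> {gmul m g h |g h. g \<in> coord_subgroup d m I \<and> h \<in> H}"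
      using C H by blast
  next
    fix x assume "x \<in> {gmul m g h |g h. g \<in> coord_subgroup d m I \<and> h \<in> H}"
    then obtain a b where "x = gmul m a b" "a \<in> coord_subgroup d m I" "b \<in> H" by blast
    moreover from this have "ginv m x = gmul m (ginv m a) (ginv m b)"
      by (auto simp: ginv_def gmul_def fun_eq_iff)
    ultimately show "ginv m x \<in> {gmul m g h |g h. g \<in> coord_subgroup d m I \<and> h \<in> H}"
      using C H by blast
  qed
qed

section \<open>Compactness and separation for the moment-angle complex and its orbit space\<close>

lemma topspace_cube_top: "topspace (cube_top m) = extensional {1..m}"
  by (simp add: cube_top_def PiE_def)

lemma Hausdorff_cube_top: "Hausdorff_space (cube_top m)"
  by (simp add: cube_top_def Hausdorff_space_product_topology)

lemma compactin_cube_PiE: "compact S \<Longrightarrow> compactin (cube_top m) (PiE {1..m} (\<lambda>_. S))"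
  by (simp add: cube_top_def compactin_PiE)

lemma continuous_map_gmul:
  "continuous_map (prod_topology (cube_top m) (cube_top m)) (cube_top m) (\<lambda>p. gmul m (fst p) (snd p))"
proof -
  have "continuous_map (prod_topology (cube_top m) (cube_top m)) euclidean (\<lambda>p. fst p i * snd p i)"
    if "i \<in> {1..m}" for i
  proof -
    have "continuous_map (cube_top m) euclidean (\<lambda>x. x i)"
      using that unfolding cube_top_def by (rule continuous_map_product_projection)
    then have a: "continuous_map (prod_topology (cube_top m) (cube_top m)) (prod_topology euclidean euclidean)
        (\<lambda>p. (fst p i, snd p i))"
      by (intro continuous_map_pairedI continuous_map_compose[OF continuous_map_fst, unfolded o_def]
          continuous_map_compose[OF continuous_map_snd, unfolded o_def])
    have b: "continuous_map (prod_topology euclidean euclidean) euclidean (\<lambda>p::complex \<times> complex. fst p * snd p)"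
      by (auto intro!: continuous_intros)
    show ?thesis
      using continuous_map_compose[OF a b] by (simp add: o_def)
  qed
  then show ?thesis
    by (subst (2) cube_top_def) (auto simp: continuous_map_componentwise gmul_def extensional_def)
qed

text \<open>The coordinates of norm below 1 form the least index set whose piece contains
  \<open>z\<close>. Since \<open>K\<close> is closed under subsets, the union over faces becomes one
  condition on norms, which the torus action visibly preserves.\<close>

lemma moment_angle_eq:
  assumes "simplicial_complex_on m K"
  shows "moment_angle d m K = {z \<in> PiE {1..m} (\<lambda>_. Dd d). {i \<in> {1..m}. norm (z i) < 1} \<in> K}"
proof (intro equalityI subsetI)
  fix z assume "z \<in> moment_angle d m K"
  then obtain I where I: "I \<in> K" "z \<in> polyhedral_product_piece d m I"
    by (auto simp: moment_angle_def)
  then have z: "z \<in> PiE {1..m} (\<lambda>_. Dd d)" "\<forall>j\<in>{1..m} - I. z j \<in> Sd d"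
    by (auto simp: polyhedral_product_piece_def)
  then have "{i \<in> {1..m}. norm (z i) < 1} \<subseteq> I"
    using Sd_iff_norm by (force simp: PiE_iff)
  then show "z \<in> {z \<in> PiE {1..m} (\<lambda>_. Dd d). {i \<in> {1..m}. norm (z i) < 1} \<in> K}"
    using z I assms by (auto simp: simplicial_complex_on_def)
next
  fix z assume z: "z \<in> {z \<in> PiE {1..m} (\<lambda>_. Dd d). {i \<in> {1..m}. norm (z i) < 1} \<in> K}"
  then have "z \<in> polyhedral_product_piece d m {i \<in> {1..m}. norm (z i) < 1}"
    using Dd_norm_le_1 Sd_iff_norm by (force simp: polyhedral_product_piece_def PiE_iff)
  with z show "z \<in> moment_angle d m K"
    by (auto simp: moment_angle_def)
qed

lemma gmul_mem_moment_angle: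
  assumes "simplicial_complex_on m K" "h \<in> Gm d m" "z \<in> moment_angle d m K"
  shows "gmul m h z \<in> moment_angle d m K"
proof -
  have "norm (h i) = 1" if "i \<in> {1..m}" for i
    using assms that Gd_closure(4) by (force simp: Gm_def PiE_iff)
  then have "{i \<in> {1..m}. norm (gmul m h z i) < 1} = {i \<in> {1..m}. norm (z i) < 1}"
    by (auto simp: gmul_def norm_mult)
  then show ?thesis
    using assms Dd_mult_Gd by (auto simp: moment_angle_eq gmul_def PiE_iff Gm_def extensional_def)
qed

lemma compactin_moment_angle:
  assumes "simplicial_complex_on m K"
  shows "compactin (cube_top m) (moment_angle d m K)"
proof -
  have "finite K"
    using assms finite_subset[of K "Pow {1..m}"] by (auto simp: simplicial_complex_on_def)
  moreover have "compactin (cube_top m) (polyhedral_product_piece d m I)" if "I \<in> K" for I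
  proof -
    have "I \<subseteq> {1..m}" using assms that by (auto simp: simplicial_complex_on_def)
    \<comment> \<open>The piece is a box with compact sides, so Tychonoff applies; the intersection
      keeps the demand that every coordinate lie in the disk.\<close>
    then have "polyhedral_product_piece d m I = PiE {1..m} (\<lambda>i. if i \<in> I then Dd d else Dd d \<inter> Sd d)"
      unfolding polyhedral_product_piece_def PiE_iff set_eq_iff mem_Collect_eq
      by (auto simp del: One_nat_def atLeastAtMost_iff split: if_splits)
    moreover have "compact (Dd d \<inter> Sd d)"
      using compact_Dd compact_Gd[of d] by (auto simp: Sd_def Gd_def intro: compact_Int)
    ultimately show ?thesis
      using compact_Dd by (auto simp: cube_top_def compactin_PiE)
  qed
  ultimately show ?thesis
    unfolding moment_angle_def by (intro compactin_Union) auto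
qed

text \<open>Closedness of \<open>H\<close> in the compact torus makes \<open>H\<close> compact,
  hence the orbit map closed, and a closed continuous image of a normal Hausdorff space is
  Hausdorff.\<close>

lemma Hausdorff_mac_orbit_space:
  assumes K: "simplicial_complex_on m K" and H: "closed_subgroup d m H"
  shows "Hausdorff_space (mac_orbit_space d m K H)"
proof -
  define M where "M = subtopology (cube_top m) (moment_angle d m K)"
  define q where "q = (\<lambda>z. {gmul m h z |h. h \<in> H})"
  have eq: "mac_orbit_space d m K H = quotient_topology M q"
    by (simp add: mac_orbit_space_def M_def q_def)
  have HG: "H \<subseteq> Gm d m" using H by (simp add: closed_subgroup_def)
  have tM: "topspace M = moment_angle d m K"
    using compactin_subset_topspace[OF compactin_moment_angle[OF K]]
    by (auto simp: M_def)
  have "compactin (cube_top m) (Gm d m)"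
    unfolding Gm_def by (intro compactin_cube_PiE compact_Gd)
  then have cH: "compactin (cube_top m) H"
    using H by (meson closed_compactin closed_subgroup_def)
  have compM: "compact_space M"
    unfolding M_def by (intro compact_space_subtopology compactin_moment_angle K)
  have HM: "Hausdorff_space M"
    unfolding M_def by (intro Hausdorff_space_subtopology Hausdorff_cube_top)
  have ext: "z \<in> extensional {1..m}" if "z \<in> topspace M" for z
    using that by (simp add: M_def topspace_cube_top)
  have quot: "quotient_map M (quotient_topology M q) q"
    by (rule quotient_map_quotient_topology)
  \<comment> \<open>The orbit map is closed because saturating a closed set multiplies two compact sets.\<close>
  have "closed_map M (quotient_topology M q) q"
    unfolding closed_map_def
  proof (intro allI impI)
    fix C assume C: "closedin M C"
    have CM: "C \<subseteq> topspace M" using C closedin_subset by blast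
    have cC: "compactin (cube_top m) C"
      using closedin_compact_space[OF compM C] by (simp add: M_def compactin_subtopology)
    define S where "S = (\<lambda>p. gmul m (fst p) (snd p)) ` (H \<times> C)"
    have "compactin (cube_top m) S"
      unfolding S_def using cH cC
      by (intro image_compactin[OF _ continuous_map_gmul]) (simp add: compactin_Times)
    moreover have SM: "S \<subseteq> moment_angle d m K"
      using CM HG K unfolding S_def tM by (auto intro!: gmul_mem_moment_angle)
    ultimately have "compactin M S"
      by (simp add: M_def compactin_subtopology)
    then have "closedin M S"
      using HM compactin_imp_closedin by blast
    moreover have "{x \<in> topspace M. q x \<in> q ` C} = S"
    proof (intro equalityI subsetI)
      fix x assume "x \<in> {x \<in> topspace M. q x \<in> q ` C}"
      then obtain y where "x \<in> topspace M" "y \<in> C" "q y = q x" by auto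
      then obtain h where "h \<in> H" "x = gmul m h y"
        unfolding q_def using orbit_eq_iff[OF closed_subgroup_imp_subgroup[OF H], of y x] ext CM by blast
      then show "x \<in> S" using \<open>y \<in> C\<close> unfolding S_def
        by (intro image_eqI[of _ _ "(h, y)"]) auto
    next
      fix x assume x: "x \<in> S"
      then obtain h y where "h \<in> H" "y \<in> C" "x = gmul m h y" by (auto simp: S_def)
      moreover have "x \<in> topspace M" using x SM tM by blast
      ultimately have "q y = q x"
        unfolding q_def using orbit_eq_iff[OF closed_subgroup_imp_subgroup[OF H], of y x] ext CM by blast
      then show "x \<in> {x \<in> topspace M. q x \<in> q ` C}"
        using \<open>x \<in> topspace M\<close> \<open>y \<in> C\<close> by auto
    qed
    moreover have "q ` C \<subseteq> topspace (quotient_topology M q)"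
      using CM by auto
    ultimately show "closedin (quotient_topology M q) (q ` C)"
      by (simp only: closedin_quotient_topology topspace_quotient_topology)
  qed
  moreover have "normal_space M"
    using compM HM compact_Hausdorff_or_regular_imp_normal_space by blast
  ultimately show ?thesis
    unfolding eq
    using normal_Hausdorff_space_closed_continuous_map_image[of M "quotient_topology M q" q]
      quotient_imp_continuous_map[OF quot] HM by simp
qed

subsection \<open>Kuhn coordinates\<close>

text \<open>The point with weights \<open>t\<close> in the Kuhn simplex whose k-th vertex is 0 on
  \<open>\<sigma> ! k\<close> and 1 elsewhere. In an ascending chain the members that miss
  \<open>i\<close> form an initial segment, so the radius is a partial sum of the weights.\<close>

definition radius :: "'i set list \<Rightarrow> (nat \<Rightarrow> real) \<Rightarrow> 'i \<Rightarrow> real" where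
  "radius \<sigma> t i = (\<Sum>k<length \<sigma>. if i \<in> \<sigma> ! k then 0 else t k)"

lemma radius_Cons: "radius (I # \<sigma>) t i = (if i \<in> I then 0 else t 0) + radius \<sigma> (\<lambda>k. t (Suc k)) i"
  unfolding radius_def by (simp only: length_Cons sum.lessThan_Suc_shift) simp

lemma radius_nonneg: "(\<And>k. k < length \<sigma> \<Longrightarrow> 0 \<le> t k) \<Longrightarrow> 0 \<le> radius \<sigma> t i"
  by (auto simp: radius_def intro: sum_nonneg)

lemma radius_le_sum: "(\<And>k. k < length \<sigma> \<Longrightarrow> 0 \<le> t k) \<Longrightarrow> radius \<sigma> t i \<le> sum t {..<length \<sigma>}"
  by (auto simp: radius_def intro: sum_mono)

lemma radius_eq_0: "(\<And>S. S \<in> set \<sigma> \<Longrightarrow> i \<in> S) \<Longrightarrow> radius \<sigma> t i = 0"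
  by (auto simp: radius_def intro: sum.neutral)

lemma radius_eq_sum: "(\<And>S. S \<in> set \<sigma> \<Longrightarrow> i \<notin> S) \<Longrightarrow> radius \<sigma> t i = sum t {..<length \<sigma>}"
  by (auto simp: radius_def intro: sum.cong)

lemma radius_hd_eq_0:
  assumes "\<sigma> \<noteq> []" "sorted_wrt (\<subset>) \<sigma>" "i \<in> hd \<sigma>"
  shows "radius \<sigma> t i = 0"
  using assms by (cases \<sigma>) (auto intro!: radius_eq_0)

text \<open>An index in the first member lies in all members of the ascending chain, while an index
  outside it collects the positive first weight. The zeros of the radius thus reveal the head of the
  chain.\<close>

lemma radius_eq_0_iff_hd:
  assumes "sorted_wrt (\<subset>) (I # \<tau>)" "\<And>k. k < length (I # \<tau>) \<Longrightarrow> 0 < t k"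
  shows "radius (I # \<tau>) t i = 0 \<longleftrightarrow> i \<in> I"
proof
  assume "i \<in> I"
  then show "radius (I # \<tau>) t i = 0"
    using assms by (auto intro!: radius_eq_0)
next
  assume 0: "radius (I # \<tau>) t i = 0"
  have "0 \<le> radius \<tau> (\<lambda>k. t (Suc k)) i"
    using assms(2) by (intro radius_nonneg less_imp_le) auto
  moreover have "0 < t 0" using assms(2) by auto
  ultimately show "i \<in> I" using 0 by (auto simp: radius_Cons split: if_splits)
qed

text \<open>The first weight is the smallest nonzero value of the radius if the chain has a second
  member, and the total weight otherwise.\<close>
lemma first_weight_le:
  assumes s: "sorted_wrt (\<subset>) (I # \<tau>')"
    and V: "\<Union>(set (I # \<tau>')) \<subseteq> V"
    and t: "\<And>k. k < length (I # \<tau>) \<Longrightarrow> 0 < t k"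
    and r: "\<And>i. i \<in> V \<Longrightarrow> radius (I # \<tau>) t i = radius (I # \<tau>') t' i"
    and sums: "sum t {..<length (I # \<tau>)} = sum t' {..<length (I # \<tau>')}"
  shows "t 0 \<le> t' 0"
proof (cases \<tau>')
  case Nil
  then have "sum t {..<length (I # \<tau>)} = t' 0" using sums by simp
  moreover have "sum t {..<length (I # \<tau>)} \<ge> t 0"
    using t by (intro member_le_sum) (auto intro: less_imp_le)
  ultimately show ?thesis by simp
next
  case (Cons J \<rho>)
  \<comment> \<open>An index that enters at the second member is missed by the first member only, so
    its radius is exactly \<open>t' 0\<close>.\<close>
  then obtain i where i: "i \<in> J" "i \<notin> I" using s by auto
  have "radius \<tau>' (\<lambda>k. t' (Suc k)) i = 0"
    using s i Cons by (intro radius_eq_0) auto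
  then have "radius (I # \<tau>') t' i = t' 0" using i by (simp add: radius_Cons)
  moreover have "0 \<le> radius \<tau> (\<lambda>k. t (Suc k)) i"
    using t by (intro radius_nonneg less_imp_le) auto
  then have "t 0 \<le> radius (I # \<tau>) t i" using i by (simp add: radius_Cons)
  moreover have "i \<in> V" using V i Cons by auto
  ultimately show ?thesis using r by simp
qed

lemma sum_pos_weights_Cons:
  assumes "\<And>k. k < length (I # \<tau>) \<Longrightarrow> 0 < t k"
  shows "0 < (sum t {..<length (I # \<tau>)} :: real)"
  using assms by (intro sum_pos) auto

text \<open>The head of the chain is the zero set of the radius and its weight is determined by
  \<open>first_weight_le\<close> in both directions; removing them leaves the same problem for the
  tails. Total weights are compared instead of being set to 1, because tails have smaller totals.
  The totals also fix the weight of a last member equal to \<open>V\<close>, which no radius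
  sees.\<close>

lemma radius_unique:
  assumes "sorted_wrt (\<subset>) \<sigma>" "sorted_wrt (\<subset>) \<sigma>'"
    and "\<Union>(set \<sigma>) \<subseteq> V" "\<Union>(set \<sigma>') \<subseteq> V"
    and "\<And>k. k < length \<sigma> \<Longrightarrow> 0 < t k" "\<And>k. k < length \<sigma>' \<Longrightarrow> 0 < t' k"
    and "\<And>i. i \<in> V \<Longrightarrow> radius \<sigma> t i = radius \<sigma>' t' i"
    and "sum t {..<length \<sigma>} = sum t' {..<length \<sigma>'}"
  shows "\<sigma> = \<sigma>' \<and> (\<forall>k<length \<sigma>. t k = t' k)"
  using assms
proof (induction \<sigma> arbitrary: \<sigma>' t t')
  case Nil
  show ?case
  proof (cases \<sigma>')
    case (Cons I' \<tau>')
    have "0 < sum t' {..<length (I' # \<tau>')}"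
      by (rule sum_pos_weights_Cons) (use Nil.prems(6) Cons in simp)
    then show ?thesis using Nil.prems(8) Cons by simp
  qed simp
next
  case (Cons I \<tau>)
  have "0 < sum t {..<length (I # \<tau>)}" by (rule sum_pos_weights_Cons) (rule Cons.prems(5))
  then have "\<sigma>' \<noteq> []" using Cons.prems(8) by auto
  then obtain I' \<tau>' where \<sigma>': "\<sigma>' = I' # \<tau>'" by (cases \<sigma>') auto
  note prems = Cons.prems[unfolded \<sigma>']
  have "i \<in> I \<longleftrightarrow> i \<in> I'" if "i \<in> V" for i
    using radius_eq_0_iff_hd[OF prems(1), of t i, OF prems(5)]
      radius_eq_0_iff_hd[OF prems(2), of t' i, OF prems(6)] prems(7)[OF that]
    by simp
  then have I: "I' = I" using prems(3,4) by auto
  note prems = prems[unfolded I]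
  have "t 0 \<le> t' 0"
    by (rule first_weight_le[OF prems(2,4,5,7,8)])
  moreover have "t' 0 \<le> t 0"
    by (rule first_weight_le[OF prems(1,3,6) prems(7)[symmetric] prems(8)[symmetric]])
  ultimately have t0: "t 0 = t' 0" by simp
  have "\<tau> = \<tau>' \<and> (\<forall>k<length \<tau>. t (Suc k) = t' (Suc k))"
  proof (rule Cons.IH)
    show "sum (\<lambda>k. t (Suc k)) {..<length \<tau>} = sum (\<lambda>k. t' (Suc k)) {..<length \<tau>'}"
      using prems(8) t0 by (simp only: length_Cons sum.lessThan_Suc_shift)
    show "radius \<tau> (\<lambda>k. t (Suc k)) i = radius \<tau>' (\<lambda>k. t' (Suc k)) i" if "i \<in> V" for i
    proof (cases "i \<in> I")
      case True
      then have "radius \<tau> (\<lambda>k. t (Suc k)) i = 0" "radius \<tau>' (\<lambda>k. t' (Suc k)) i = 0"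
        using prems(1,2) by (auto intro!: radius_eq_0)
      then show ?thesis by simp
    next
      case False
      then show ?thesis using prems(7)[OF that] t0 by (simp add: radius_Cons)
    qed
  qed (use prems(1-6) in auto)
  then show ?case
    using t0 by (auto simp: \<sigma>' I less_Suc_eq_0_disj)
qed

lemma std_simplex_sum: "t \<in> std_simplex n \<Longrightarrow> sum t {..<Suc n} = 1"
  by (simp add: std_simplex_def lessThan_Suc_atMost)

text \<open>The Kuhn triangulation: sublevel sets of the coordinates form the chain, and the gaps
  between consecutive values (starting at 0 and ending at 1) are the barycentric coordinates.\<close>
lemma radius_exists:
  fixes r :: "'i \<Rightarrow> real"
  assumes V: "finite V" and r: "\<And>i. i \<in> V \<Longrightarrow> 0 \<le> r i" "\<And>i. i \<in> V \<Longrightarrow> r i \<le> 1"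
  obtains \<sigma> t where "\<sigma> \<noteq> []" "sorted_wrt (\<subset>) \<sigma>" "\<And>S. S \<in> set \<sigma> \<Longrightarrow> S \<subseteq> {i \<in> V. r i < 1}"
    "t \<in> std_simplex (length \<sigma> - 1)" "\<And>i. i \<in> V \<Longrightarrow> radius \<sigma> t i = r i"
proof -
  \<comment> \<open>The value 0 is inserted even if no radius attains it, so that the list is
    nonempty and the gaps start at 0; the chain then begins with the empty set. The value 1 is left
    out because its sublevel set is all of \<open>V\<close>, which may exceed the set where
    \<open>r\<close> is below 1.\<close>
  define A where "A = insert 0 {v \<in> r ` V. v < 1}"
  have fA: "finite A" and A0: "\<And>a. a \<in> A \<Longrightarrow> 0 \<le> a" and A1: "\<And>a. a \<in> A \<Longrightarrow> a < 1"
    using V r by (auto simp: A_def)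
  define vs where "vs = sorted_list_of_set A"
  have set_vs: "set vs = A" and sorted: "sorted_wrt (<) vs"
    using fA by (auto simp: vs_def)
  define n where "n = length vs"
  have n: "n > 0" using set_vs by (auto simp: n_def A_def)
  \<comment> \<open>Setting \<open>v n = 1\<close> supplies the endpoint of the last gap, which
    makes the weights add up to 1.\<close>
  define v where "v k = (if k < n then vs ! k else 1)" for k
  have v_less: "v j < v k" if "j < k" "k \<le> n" for j k
  proof -
    have "vs ! j \<in> A" using that by (simp add: n_def flip: set_vs)
    then show ?thesis
      using that A1 sorted_wrt_nth_less[OF sorted, of j k] by (auto simp: v_def n_def)
  qed
  have v_le: "v j \<le> v k" if "j \<le> k" "k \<le> n" for j k
    using v_less[of j k] that by (cases "j = k") auto
  have v0: "v 0 = 0"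
  proof -
    obtain p where "p < n" "vs ! p = 0"
      using set_vs by (metis A_def in_set_conv_nth insertI1 n_def)
    then have "v 0 \<le> 0" using v_le[of 0 p] by (auto simp: v_def)
    moreover have "vs ! 0 \<in> A" using n by (simp add: n_def flip: set_vs)
    ultimately show ?thesis using A0 n by (auto simp: v_def intro: antisym)
  qed
  define \<sigma> where "\<sigma> = map (\<lambda>x. {i \<in> V. r i \<le> x}) vs"
  define t where "t k = (if k < n then v (Suc k) - v k else 0)" for k
  have nth: "\<sigma> ! k = {i \<in> V. r i \<le> v k}" if "k < n" for k
    using that by (simp add: \<sigma>_def v_def n_def)
  have len: "length \<sigma> = n" by (simp add: \<sigma>_def n_def)
  have telescope: "sum t {..<p} = v p" if "p \<le> n" for p
  proof -
    have "sum t {..<p} = (\<Sum>k<p. v (Suc k) - v k)"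
      using that by (intro sum.cong) (auto simp: t_def)
    then show ?thesis by (simp add: sum_lessThan_telescope v0)
  qed
  show ?thesis
  proof
    show "\<sigma> \<noteq> []" using n len by auto
    show "sorted_wrt (\<subset>) \<sigma>"
      unfolding sorted_wrt_iff_nth_less len
    proof (intro allI impI)
      fix j k assume jk: "j < k" "k < n"
      have lt: "v j < v k" using v_less jk by simp
      \<comment> \<open>Only the inserted 0 can be unattained, and it comes first. Every later value
        is attained at an index that makes the inclusion strict.\<close>
      have "vs ! k \<in> A" using jk by (simp add: n_def flip: set_vs)
      moreover have "v k > 0" using v_less[of 0 k] jk v0 by simp
      ultimately obtain i where "i \<in> V" "r i = v k"
        using jk by (auto simp: A_def v_def)
      then have "i \<in> \<sigma> ! k" "i \<notin> \<sigma> ! j" "\<sigma> ! j \<subseteq> \<sigma> ! k"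
        using lt jk by (auto simp: nth)
      then show "\<sigma> ! j \<subset> \<sigma> ! k" by blast
    qed
    show "S \<subseteq> {i \<in> V. r i < 1}" if "S \<in> set \<sigma>" for S
      using that A1 set_vs by (fastforce simp: \<sigma>_def)
    have "sum t {..n - 1} = 1"
      using telescope[of n] n by (cases n) (auto simp: lessThan_Suc_atMost v_def)
    moreover have "0 \<le> t k" for k using v_le[of k "Suc k"] by (auto simp: t_def)
    ultimately show "t \<in> std_simplex (length \<sigma> - 1)"
      by (auto simp: std_simplex_def len t_def)
    show "radius \<sigma> t i = r i" if i: "i \<in> V" for i
    proof -
      obtain p where p: "p \<le> n" "r i = v p"
      proof (cases "r i = 1")
        case True
        then show ?thesis using that[of n] by (simp add: v_def)
      next
        case False
        then have "r i \<in> set vs" using i r[of i] set_vs by (auto simp: A_def)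
        then obtain p where "p < n" "vs ! p = r i" by (auto simp: in_set_conv_nth n_def)
        then show ?thesis using that[of p] by (simp add: v_def)
      qed
      \<comment> \<open>The index \<open>i\<close> lies in the k-th sublevel set exactly from
        \<open>p\<close> on, so its radius is the sum of the first \<open>p\<close> gaps and
        telescopes to \<open>v p\<close>. A radius equal to 1 is the case
        \<open>p = n\<close>.\<close>
      have "v p \<le> v k \<longleftrightarrow> p \<le> k" if "k < n" for k
        using v_le[of p k] v_less[of k p] p that by force
      then have "radius \<sigma> t i = (\<Sum>k<n. if p \<le> k then 0 else t k)"
        using i p by (auto simp: radius_def len nth intro!: sum.cong)
      also have "\<dots> = sum t {..<p}"
        using p by (intro sum.mono_neutral_cong_right) auto
      also have "\<dots> = r i" using telescope p by simp
      finally show ?thesis .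
    qed
  qed
qed

section \<open>Face operators on chains and on barycentric coordinates\<close>

lemma del_nth_Cons: "del_nth 0 (x # xs) = xs" "del_nth (Suc k) (x # xs) = x # del_nth k xs"
  by (simp_all add: del_nth_def)

lemma length_del_nth: "k < length xs \<Longrightarrow> length (del_nth k xs) = length xs - 1"
  by (simp add: del_nth_def)

lemma drop_coord_Suc: "drop_coord (Suc k) t 0 = t 0"
  "drop_coord (Suc k) t (Suc j) = drop_coord k (\<lambda>j. t (Suc j)) j"
  by (auto simp: drop_coord_def)

text \<open>A vertex of weight 0 contributes nothing to a barycentric combination, so the radii are
  constant along face identifications. This includes \<open>k = 0\<close>, where the head of the
  chain changes.\<close>

lemma radius_del_nth:
  assumes "k < length \<sigma>" "t k = 0"
  shows "radius (del_nth k \<sigma>) (drop_coord k t) i = radius \<sigma> t i"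
  using assms
proof (induction k arbitrary: \<sigma> t)
  case 0
  then show ?case by (cases \<sigma>) (auto simp: del_nth_Cons radius_Cons drop_coord_def)
next
  case (Suc k)
  then show ?case
    by (cases \<sigma>) (auto simp: del_nth_Cons radius_Cons drop_coord_Suc)
qed

lemma drop_coord_mem_std_simplex:
  assumes t: "t \<in> std_simplex n" and k: "k \<le> n" "t k = 0" and "n \<ge> 1"
  shows "drop_coord k t \<in> std_simplex (n - 1)"
proof -
  \<comment> \<open>Only the bound on \<open>k\<close> and \<open>t k = 0\<close> enter the
    induction, since weights shifted by one need no longer sum to 1.\<close>
  have "sum (drop_coord k t) {..<n} = sum t {..<Suc n}"
    using k
  proof (induction k arbitrary: t n)
    case 0
    then show ?case by (subst sum.lessThan_Suc_shift) (simp add: drop_coord_def)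
  next
    case (Suc k)
    then obtain n' where n': "n = Suc n'" by (cases n) auto
    show ?case
      using Suc.IH[of n' "\<lambda>j. t (Suc j)"] Suc.prems
      unfolding n' sum.lessThan_Suc_shift[of _ "Suc n'"] sum.lessThan_Suc_shift[of "drop_coord (Suc k) t"]
      by (simp add: drop_coord_Suc del: sum.lessThan_Suc)
  qed
  moreover have "{..<n} = {..n - 1}" using \<open>n \<ge> 1\<close> by auto
  ultimately show ?thesis
    using t k std_simplex_sum[OF t] by (auto simp: std_simplex_def drop_coord_def)
qed

lemma del_nth_mem_chains:
  assumes "\<sigma> \<in> chains P" "2 \<le> length \<sigma>" "k < length \<sigma>"
  shows "del_nth k \<sigma> \<in> chains P"
proof -
  have \<sigma>: "\<sigma> = take k \<sigma> @ \<sigma> ! k # drop (Suc k) \<sigma>"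
    using assms by (simp add: id_take_nth_drop)
  have "sorted_wrt (\<subset>) (take k \<sigma> @ \<sigma> ! k # drop (Suc k) \<sigma>)"
    using assms \<sigma> by (simp add: chains_def)
  then have "sorted_wrt (\<subset>) (del_nth k \<sigma>)"
    by (auto simp: sorted_wrt_append del_nth_def)
  moreover have "set (del_nth k \<sigma>) \<subseteq> set \<sigma>"
    using set_take_subset[of k \<sigma>] set_drop_subset[of "Suc k" \<sigma>] by (auto simp: del_nth_def)
  moreover have "del_nth k \<sigma> \<noteq> []"
    using length_del_nth[of k \<sigma>] assms by auto
  ultimately show ?thesis
    using assms by (auto simp: chains_def)
qed

lemma hd_del_nth: "2 \<le> length \<sigma> \<Longrightarrow> hd (del_nth k \<sigma>) = (if k = 0 then \<sigma> ! 1 else hd \<sigma>)"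
  by (cases \<sigma>; cases k; cases "tl \<sigma>") (auto simp: del_nth_Cons)

lemma topspace_simplex_top: "topspace (simplex_top n) = std_simplex n"
  by (simp add: simplex_top_def)

subsection \<open>Normal forms in the homotopy colimit\<close>

lemma mem_topspace_bk_total:
  "(\<sigma>, (x, t)) \<in> topspace (bk_total P F) \<longleftrightarrow>
     \<sigma> \<in> chains P \<and> x \<in> topspace (F (hd \<sigma>)) \<and> t \<in> std_simplex (length \<sigma> - 1)"
  by (auto simp: bk_total_def topspace_simplex_top)

lemma bk_equiv_step:
  assumes "p \<in> topspace (bk_total P F)" "q \<in> topspace (bk_total P F)" "bk_face f p q"
  shows "bk_equiv P F f p q"
  using assms by (auto simp: bk_equiv_def intro!: r_into_rtranclp)

lemma bk_equiv_refl: "p \<in> topspace (bk_total P F) \<Longrightarrow> bk_equiv P F f p p"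
  by (simp add: bk_equiv_def)

lemma bk_equiv_trans: "bk_equiv P F f p q \<Longrightarrow> bk_equiv P F f q r \<Longrightarrow> bk_equiv P F f p r"
  by (auto simp: bk_equiv_def)

lemma bk_equiv_sym: 
  assumes "bk_equiv P F f p q"
  shows "bk_equiv P F f q p"
proof -
  let ?R = "\<lambda>a b. a \<in> topspace (bk_total P F) \<and> b \<in> topspace (bk_total P F) \<and>
             (bk_face f a b \<or> bk_face f b a)"
  have "symp ?R" by (auto intro: sympI)
  then have "symp ?R\<^sup>*\<^sup>*" by (rule symp_rtranclp)
  then show ?thesis
    using assms unfolding bk_equiv_def by (blast dest: sympD)
qed

lemma bk_class_eq_iff:
  assumes "p \<in> topspace (bk_total P F)" "q \<in> topspace (bk_total P F)"
  shows "{r. bk_equiv P F f p r} = {r. bk_equiv P F f q r} \<longleftrightarrow> bk_equiv P F f p q"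
  using assms bk_equiv_refl bk_equiv_sym bk_equiv_trans by blast

lemma bk_face_mem_topspace:
  assumes f: "\<And>I J x. I \<in> P \<Longrightarrow> J \<in> P \<Longrightarrow> I \<subseteq> J \<Longrightarrow> x \<in> topspace (F I) \<Longrightarrow> f I J x \<in> topspace (F J)"
    and p: "(\<sigma>, (x, t)) \<in> topspace (bk_total P F)"
    and k: "2 \<le> length \<sigma>" "k < length \<sigma>" "t k = 0"
  shows "(del_nth k \<sigma>, ((if k = 0 then f (\<sigma> ! 0) (\<sigma> ! 1) x else x), drop_coord k t))
           \<in> topspace (bk_total P F)"
proof -
  have \<sigma>: "\<sigma> \<in> chains P" "x \<in> topspace (F (hd \<sigma>))" "t \<in> std_simplex (length \<sigma> - 1)"
    using p by (auto simp: mem_topspace_bk_total)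
  obtain I J \<tau> where IJ: "\<sigma> = I # J # \<tau>"
    using k(1) by (metis One_nat_def Suc_1 Suc_le_length_iff)
  have "f (\<sigma> ! 0) (\<sigma> ! 1) x \<in> topspace (F (\<sigma> ! 1))"
    using \<sigma> by (auto simp: IJ chains_def intro!: f)
  then show ?thesis
    using \<sigma> k drop_coord_mem_std_simplex[OF \<sigma>(3), of k]
    by (auto simp: mem_topspace_bk_total del_nth_mem_chains hd_del_nth length_del_nth)
qed

text \<open>A vanishing weight permits a face identification that shortens the chain. The descent
  cannot get stuck at a single member, whose weight must be 1.\<close>

lemma bk_normal_form:
  assumes f: "\<And>I J x. I \<in> P \<Longrightarrow> J \<in> P \<Longrightarrow> I \<subseteq> J \<Longrightarrow> x \<in> topspace (F I) \<Longrightarrow> f I J x \<in> topspace (F J)"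
    and p: "(\<sigma>, (x, t)) \<in> topspace (bk_total P F)"
  shows "\<exists>\<sigma>' x' t'. bk_equiv P F f (\<sigma>, (x, t)) (\<sigma>', (x', t')) \<and> (\<forall>k<length \<sigma>'. 0 < t' k)"
  using p
proof (induction "length \<sigma>" arbitrary: \<sigma> x t rule: less_induct)
  case less
  have \<sigma>: "\<sigma> \<in> chains P" "t \<in> std_simplex (length \<sigma> - 1)"
    using less.prems by (auto simp: mem_topspace_bk_total)
  then have ge0: "\<And>k. 0 \<le> t k" by (auto simp: std_simplex_def)
  show ?case
  proof (cases "\<forall>k<length \<sigma>. 0 < t k")
    case True
    then show ?thesis using bk_equiv_refl[OF less.prems] by blast
  next
    case False
    then obtain k where k: "k < length \<sigma>" "t k = 0"
      using ge0 by (metis order_le_less)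
    have "length \<sigma> \<noteq> 1"
      using k std_simplex_sum[OF \<sigma>(2)] by auto
    then have 2: "2 \<le> length \<sigma>" using k by linarith
    define x1 where "x1 = (if k = 0 then f (\<sigma> ! 0) (\<sigma> ! 1) x else x)"
    have mem: "(del_nth k \<sigma>, (x1, drop_coord k t)) \<in> topspace (bk_total P F)"
      unfolding x1_def by (rule bk_face_mem_topspace[OF f less.prems 2 k])
    have "bk_face f (\<sigma>, (x, t)) (del_nth k \<sigma>, (x1, drop_coord k t))"
      unfolding bk_face_def x1_def using k 2 by blast
    then have "bk_equiv P F f (\<sigma>, (x, t)) (del_nth k \<sigma>, (x1, drop_coord k t))"
      by (rule bk_equiv_step[OF less.prems mem])
    moreover have "length (del_nth k \<sigma>) < length \<sigma>"
      using k by (simp add: length_del_nth)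
    then obtain \<sigma>' x' t' where "bk_equiv P F f (del_nth k \<sigma>, (x1, drop_coord k t)) (\<sigma>', (x', t'))"
      "\<forall>k<length \<sigma>'. 0 < t' k"
      using less.hyps mem by blast
    ultimately show ?thesis using bk_equiv_trans by blast
  qed
qed

subsection \<open>The homeomorphism\<close>

definition polar_point :: "nat \<Rightarrow> nat set list \<Rightarrow> (nat \<Rightarrow> real) \<Rightarrow> (nat \<Rightarrow> complex) \<Rightarrow> nat \<Rightarrow> complex" where
  "polar_point m \<sigma> t g = gmul m g (\<lambda>i. of_real (radius \<sigma> t i))"

text \<open>Taking the image of the whole coset avoids choosing a representative;
  \<open>collapse_coset\<close> shows that this image is a single \<open>H\<close>-orbit.\<close>

definition collapse :: "nat \<Rightarrow> nat set list \<times> ((nat \<Rightarrow> complex) set \<times> (nat \<Rightarrow> real))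
    \<Rightarrow> (nat \<Rightarrow> complex) set" where
  "collapse m p = (case p of (\<sigma>, (c, t)) \<Rightarrow> polar_point m \<sigma> t ` c)"

lemma gmul_extensional: "gmul m a b \<in> extensional {1..m}"
  by (auto simp: gmul_def extensional_def)

lemma norm_polar_point:
  assumes "g \<in> Gm d m" "i \<in> {1..m}" "0 \<le> radius \<sigma> t i"
  shows "norm (polar_point m \<sigma> t g i) = radius \<sigma> t i"
proof -
  have "norm (g i) = 1" using assms Gd_closure(4)[of "g i" d] by (auto simp: Gm_def PiE_iff)
  then show ?thesis using assms by (simp add: polar_point_def gmul_def norm_mult)
qed

lemma polar_point_gmul: "polar_point m \<sigma> t (gmul m h g) = gmul m h (polar_point m \<sigma> t g)"
  by (simp add: polar_point_def gmul_assoc)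

text \<open>The element \<open>a\<close> moves only coordinates in the head of the chain, and there
  the radius is 0.\<close>

lemma polar_point_coord_subgroup:
  assumes "\<sigma> \<noteq> []" "sorted_wrt (\<subset>) \<sigma>" "a \<in> coord_subgroup d m (hd \<sigma>)"
  shows "gmul m a (polar_point m \<sigma> t g) = polar_point m \<sigma> t g"
proof
  fix i
  show "gmul m a (polar_point m \<sigma> t g) i = polar_point m \<sigma> t g i"
    using radius_hd_eq_0[OF assms(1,2), of i t] assms(3)
    by (cases "i \<in> hd \<sigma>") (auto simp: gmul_def polar_point_def coord_subgroup_def)
qed

lemma topspace_tq_diagram:
  "topspace (tq_diagram d m H I) = (\<lambda>g. {gmul m g l |l. l \<in> join_subgroup d m I H}) ` Gm d m"
proof -
  have "Gm d m \<subseteq> topspace (cube_top m)"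
    by (auto simp: topspace_cube_top dest: Gm_extensional)
  then show ?thesis
    by (simp add: tq_diagram_def coset_space_def Int_absorb1)
qed

text \<open>Of an element of the joined subgroup, the coordinate factor is absorbed by the vanishing
  radii and the factor from \<open>H\<close> moves the point along its orbit. Commutativity brings
  both to the left of \<open>g\<close>.\<close>

lemma collapse_coset:
  assumes \<sigma>: "\<sigma> \<noteq> []" "sorted_wrt (\<subset>) \<sigma>"
  shows "collapse m (\<sigma>, ({gmul m g l |l. l \<in> join_subgroup d m (hd \<sigma>) H}, t)) =
           {gmul m h (polar_point m \<sigma> t g) |h. h \<in> H}"
proof -
  have *: "polar_point m \<sigma> t (gmul m g (gmul m a h)) = gmul m h (polar_point m \<sigma> t g)"
    if "a \<in> coord_subgroup d m (hd \<sigma>)" for a h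
  proof -
    have "gmul m g (gmul m a h) = gmul m h (gmul m a g)" by (simp add: gmul_ac)
    then show ?thesis
      by (simp only: polar_point_gmul polar_point_coord_subgroup[OF \<sigma> that])
  qed
  have one: "gone m \<in> coord_subgroup d m (hd \<sigma>)"
    using Gm_closure(1) by (auto simp: coord_subgroup_def) (simp add: gone_def)
  show ?thesis
  proof (intro equalityI subsetI)
    fix z assume "z \<in> collapse m (\<sigma>, ({gmul m g l |l. l \<in> join_subgroup d m (hd \<sigma>) H}, t))"
    then obtain a h where "a \<in> coord_subgroup d m (hd \<sigma>)" "h \<in> H"
      "z = polar_point m \<sigma> t (gmul m g (gmul m a h))"
      by (auto simp: collapse_def join_subgroup_def)
    then show "z \<in> {gmul m h (polar_point m \<sigma> t g) |h. h \<in> H}"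
      using * by blast
  next
    fix z assume "z \<in> {gmul m h (polar_point m \<sigma> t g) |h. h \<in> H}"
    then obtain h where h: "h \<in> H" "z = gmul m h (polar_point m \<sigma> t g)" by blast
    then have z: "z = polar_point m \<sigma> t (gmul m g (gmul m (gone m) h))"
      using *[OF one] by simp
    have "gmul m (gone m) h \<in> join_subgroup d m (hd \<sigma>) H"
      unfolding join_subgroup_def using one h(1) by blast
    then show "z \<in> collapse m (\<sigma>, ({gmul m g l |l. l \<in> join_subgroup d m (hd \<sigma>) H}, t))"
      unfolding collapse_def prod.case z by blast
  qed
qed

lemma tq_proj_coset:
  assumes H: "subgroup_of_Gm d m H" and IJ: "I \<subseteq> J" and g: "g \<in> Gm d m"
  shows "tq_proj d m H I J {gmul m g l |l. l \<in> join_subgroup d m I H} =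
           {gmul m g l |l. l \<in> join_subgroup d m J H}"
proof (intro equalityI subsetI)
  have J: "subgroup_of_Gm d m (join_subgroup d m J H)"
    by (rule subgroup_join_subgroup[OF H])
  have "coord_subgroup d m I \<subseteq> coord_subgroup d m J"
    using IJ by (auto simp: coord_subgroup_def)
  then have sub: "join_subgroup d m I H \<subseteq> join_subgroup d m J H"
    by (auto simp: join_subgroup_def)
  fix x assume "x \<in> tq_proj d m H I J {gmul m g l |l. l \<in> join_subgroup d m I H}"
  then obtain k l where "k \<in> join_subgroup d m I H" "l \<in> join_subgroup d m J H"
    "x = gmul m (gmul m g k) l" by (auto simp: tq_proj_def)
  moreover from this have "gmul m k l \<in> join_subgroup d m J H"
    using sub J by (auto simp: subgroup_of_Gm_def)
  ultimately show "x \<in> {gmul m g l |l. l \<in> join_subgroup d m J H}"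
    by (auto simp: gmul_assoc)
next
  fix x assume "x \<in> {gmul m g l |l. l \<in> join_subgroup d m J H}"
  then obtain l where l: "l \<in> join_subgroup d m J H" "x = gmul m g l" by blast
  have "g = gmul m g (gone m)"
    using gmul_gone[OF Gm_extensional[OF g]] gmul_commute by metis
  moreover have "gone m \<in> join_subgroup d m I H"
    using subgroup_join_subgroup[OF H] by (simp add: subgroup_of_Gm_def)
  ultimately have "g \<in> {gmul m g l |l. l \<in> join_subgroup d m I H}" by blast
  then show "x \<in> tq_proj d m H I J {gmul m g l |l. l \<in> join_subgroup d m I H}"
    unfolding tq_proj_def using l by blast
qed

lemma tq_proj_mem_topspace:
  assumes "subgroup_of_Gm d m H" "I \<subseteq> J" "c \<in> topspace (tq_diagram d m H I)"
  shows "tq_proj d m H I J c \<in> topspace (tq_diagram d m H J)"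
  using assms by (auto simp: topspace_tq_diagram tq_proj_coset)

text \<open>The same \<open>g\<close> represents the coset before and after the identification, even
  when \<open>k = 0\<close> enlarges the subgroup, and its polar point does not change because the
  radii do not.\<close>

lemma collapse_face:
  assumes H: "subgroup_of_Gm d m H" and p: "p \<in> topspace (bk_total K (tq_diagram d m H))"
    and face: "bk_face (tq_proj d m H) p q"
  shows "collapse m p = collapse m q"
proof -
  obtain \<sigma> c t k where pq: "p = (\<sigma>, (c, t))" "2 \<le> length \<sigma>" "k < length \<sigma>" "t k = 0"
    "q = (del_nth k \<sigma>, ((if k = 0 then tq_proj d m H (\<sigma> ! 0) (\<sigma> ! 1) c else c), drop_coord k t))"
    using face unfolding bk_face_def by blast
  have \<sigma>: "\<sigma> \<in> chains K" "c \<in> topspace (tq_diagram d m H (hd \<sigma>))"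
    using p by (auto simp: pq mem_topspace_bk_total)
  have s: "\<sigma> \<noteq> []" "sorted_wrt (\<subset>) \<sigma>" using \<sigma> by (auto simp: chains_def)
  have "del_nth k \<sigma> \<in> chains K" using del_nth_mem_chains \<sigma>(1) pq by blast
  then have s': "del_nth k \<sigma> \<noteq> []" "sorted_wrt (\<subset>) (del_nth k \<sigma>)" by (auto simp: chains_def)
  obtain g where g: "g \<in> Gm d m" "c = {gmul m g l |l. l \<in> join_subgroup d m (hd \<sigma>) H}"
    using \<sigma>(2) by (auto simp: topspace_tq_diagram)
  have hd: "hd \<sigma> = \<sigma> ! 0" using s by (simp add: hd_conv_nth)
  have "\<sigma> ! 0 \<subseteq> \<sigma> ! 1" using sorted_wrt_nth_less[OF s(2), of 0 1] pq(2) by auto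
  then have q': "q = (del_nth k \<sigma>, ({gmul m g l |l. l \<in> join_subgroup d m (hd (del_nth k \<sigma>)) H}, drop_coord k t))"
    using tq_proj_coset[OF H _ g(1), of "\<sigma> ! 0" "\<sigma> ! 1"] by (simp add: pq g(2) hd_del_nth hd)
  have "polar_point m (del_nth k \<sigma>) (drop_coord k t) g = polar_point m \<sigma> t g"
    unfolding polar_point_def radius_del_nth[OF pq(3), of t, OF pq(4)] ..
  then show ?thesis
    unfolding q' pq(1) g(2) collapse_coset[OF s] collapse_coset[OF s'] by simp
qed

lemma collapse_equiv:
  assumes H: "subgroup_of_Gm d m H" and "bk_equiv K (tq_diagram d m H) (tq_proj d m H) p q"
  shows "collapse m p = collapse m q"
proof -
  let ?T = "topspace (bk_total K (tq_diagram d m H))"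
  have "(\<lambda>a b. a \<in> ?T \<and> b \<in> ?T \<and> (bk_face (tq_proj d m H) a b \<or> bk_face (tq_proj d m H) b a))\<^sup>*\<^sup>* p q"
    using assms(2) unfolding bk_equiv_def by blast
  then show ?thesis
  proof (induction rule: rtranclp_induct)
    case (step y z)
    then have "collapse m y = collapse m z"
      using collapse_face[OF H, of y K z] collapse_face[OF H, of z K y] by (elim conjE disjE) simp_all
    with step.IH show ?case by simp
  qed simp
qed

text \<open>Multiplication by \<open>H\<close> preserves norms, so equal orbits have equal radii,
  and positivity lets \<open>radius_unique\<close> recover chain and weights. The group elements can
  then differ only by \<open>H\<close> and by coordinates of radius 0, that is, within one
  coset.\<close>

lemma collapse_inj_on_normal_forms:
  assumes H: "subgroup_of_Gm d m H" and K: "\<And>I. I \<in> K \<Longrightarrow> I \<subseteq> {1..m}"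
    and p: "(\<sigma>, (c, t)) \<in> topspace (bk_total K (tq_diagram d m H))"
    and p': "(\<sigma>', (c', t')) \<in> topspace (bk_total K (tq_diagram d m H))"
    and t: "\<And>k. k < length \<sigma> \<Longrightarrow> 0 < t k" and t': "\<And>k. k < length \<sigma>' \<Longrightarrow> 0 < t' k"
    and eq: "collapse m (\<sigma>, (c, t)) = collapse m (\<sigma>', (c', t'))"
  shows "(\<sigma>, (c, t)) = (\<sigma>', (c', t'))"
proof -
  have \<sigma>: "\<sigma> \<in> chains K" "c \<in> topspace (tq_diagram d m H (hd \<sigma>))" "t \<in> std_simplex (length \<sigma> - 1)"
    using p by (auto simp: mem_topspace_bk_total)
  have \<sigma>': "\<sigma>' \<in> chains K" "c' \<in> topspace (tq_diagram d m H (hd \<sigma>'))" "t' \<in> std_simplex (length \<sigma>' - 1)"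
    using p' by (auto simp: mem_topspace_bk_total)
  have s: "\<sigma> \<noteq> []" "sorted_wrt (\<subset>) \<sigma>" and s': "\<sigma>' \<noteq> []" "sorted_wrt (\<subset>) \<sigma>'"
    using \<sigma> \<sigma>' by (auto simp: chains_def)
  have len: "Suc (length \<sigma> - 1) = length \<sigma>" "Suc (length \<sigma>' - 1) = length \<sigma>'"
    using s s' by auto
  obtain g where g: "g \<in> Gm d m" "c = {gmul m g l |l. l \<in> join_subgroup d m (hd \<sigma>) H}"
    using \<sigma>(2) by (auto simp: topspace_tq_diagram)
  obtain g' where g': "g' \<in> Gm d m" "c' = {gmul m g' l |l. l \<in> join_subgroup d m (hd \<sigma>') H}"
    using \<sigma>'(2) by (auto simp: topspace_tq_diagram)
  have ext: "polar_point m \<sigma> t g \<in> extensional {1..m}" for \<sigma> t g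
    unfolding polar_point_def by (rule gmul_extensional)
  have "\<exists>h\<in>H. polar_point m \<sigma>' t' g' = gmul m h (polar_point m \<sigma> t g)"
    using eq unfolding g(2) g'(2) collapse_coset[OF s] collapse_coset[OF s']
      orbit_eq_iff[OF H ext[of \<sigma> t g] ext[of \<sigma>' t' g']] .
  then obtain h where h: "h \<in> H" "polar_point m \<sigma>' t' g' = gmul m h (polar_point m \<sigma> t g)"
    by blast
  have hG: "h \<in> Gm d m" using h(1) H by (auto simp: subgroup_of_Gm_def)
  have r: "radius \<sigma> t i = radius \<sigma>' t' i" if i: "i \<in> {1..m}" for i
  proof -
    have "0 \<le> radius \<sigma> t i" "0 \<le> radius \<sigma>' t' i"
      using \<sigma>(3) \<sigma>'(3) by (auto intro!: radius_nonneg simp: std_simplex_def)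
    moreover have "norm (polar_point m \<sigma> t (gmul m h g) i) = norm (polar_point m \<sigma>' t' g' i)"
      using h(2) by (simp add: polar_point_gmul)
    ultimately show ?thesis
      using norm_polar_point[OF Gm_closure(2)[OF hG g(1)] i] norm_polar_point[OF g'(1) i] by simp
  qed
  have "\<sigma> = \<sigma>' \<and> (\<forall>k<length \<sigma>. t k = t' k)"
  proof (rule radius_unique[where V = "{1..m}"])
    show "\<Union> (set \<sigma>) \<subseteq> {1..m}" "\<Union> (set \<sigma>') \<subseteq> {1..m}"
      using \<sigma>(1) \<sigma>'(1) K unfolding chains_def by blast+
    show "sum t {..<length \<sigma>} = sum t' {..<length \<sigma>'}"
      using std_simplex_sum[OF \<sigma>(3)] std_simplex_sum[OF \<sigma>'(3)] unfolding len by simp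
  qed (use s s' t t' r in auto)
  then have [simp]: "\<sigma>' = \<sigma>" and tk: "\<And>k. k < length \<sigma> \<Longrightarrow> t k = t' k" by auto
  \<comment> \<open>Weights are functions on all natural numbers; beyond the chain both vanish by
    definition of the simplex.\<close>
  have "t k = t' k" for k
  proof (cases "k < length \<sigma>")
    case False
    then have "length \<sigma> - 1 < k" using len(1) by linarith
    then show ?thesis using \<sigma>(3) \<sigma>'(3) by (simp add: std_simplex_def)
  qed (rule tk)
  then have [simp]: "t' = t" by auto
  \<comment> \<open>The discrepancy between \<open>g'\<close> and \<open>h g\<close>. Wherever the
    radius is nonzero it cancels from the equality of polar points, so \<open>a\<close> is 1 off the
    head of the chain.\<close>
  define a where "a = gmul m (ginv m (gmul m h g)) g'"
  have hg: "gmul m h g \<in> Gm d m" by (rule Gm_closure(2)[OF hG g(1)])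
  have aG: "a \<in> Gm d m"
    unfolding a_def by (rule Gm_closure(2)[OF Gm_closure(3)[OF hg] g'(1)])
  have "a j = 1" if j: "j \<in> {1..m} - hd \<sigma>" for j
  proof -
    have "radius \<sigma> t j \<noteq> 0"
      using radius_eq_0_iff_hd[of "hd \<sigma>" "tl \<sigma>" t j] s t j by simp
    moreover have "polar_point m \<sigma> t g' j = polar_point m \<sigma> t (gmul m h g) j"
      using h(2) by (simp add: polar_point_gmul)
    ultimately have "g' j = gmul m h g j"
      using j by (simp add: polar_point_def gmul_def)
    then show ?thesis
      using j Gm_nonzero[OF hg, of j] by (simp add: a_def gmul_def ginv_def field_simps)
  qed
  then have "a \<in> coord_subgroup d m (hd \<sigma>)"
    using aG unfolding coord_subgroup_def by blast
  then have mem: "gmul m a h \<in> join_subgroup d m (hd \<sigma>) H"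
    using h(1) unfolding join_subgroup_def by blast
  have "gmul m (gmul m h g) a = g'"
  proof -
    have "gmul m (gmul m h g) a = gmul m (ginv m (gmul m h g)) (gmul m (gmul m h g) g')"
      unfolding a_def by (rule gmul_left_commute)
    then show ?thesis
      using gmul_ginv_cancel[OF hg Gm_extensional[OF g'(1)]] by simp
  qed
  then have "g' = gmul m (gmul m a h) g" by (simp add: gmul_ac)
  then have "{gmul m l g |l. l \<in> join_subgroup d m (hd \<sigma>) H} =
      {gmul m l g' |l. l \<in> join_subgroup d m (hd \<sigma>) H}"
    unfolding orbit_eq_iff[OF subgroup_join_subgroup[OF H] Gm_extensional[OF g(1)] Gm_extensional[OF g'(1)]]
    using mem by blast
  then have "c = c'"
    unfolding g(2) g'(2) by (simp add: gmul_commute[of m g] gmul_commute[of m g'])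
  then show ?thesis by simp
qed

text \<open>Both points are equivalent to normal forms with the same images; by injectivity these
  coincide and link \<open>p\<close> to \<open>q\<close>.\<close>

lemma collapse_eq_iff:
  assumes H: "subgroup_of_Gm d m H" and K: "\<And>I. I \<in> K \<Longrightarrow> I \<subseteq> {1..m}"
    and p: "p \<in> topspace (bk_total K (tq_diagram d m H))"
    and q: "q \<in> topspace (bk_total K (tq_diagram d m H))"
  shows "collapse m p = collapse m q \<longleftrightarrow> bk_equiv K (tq_diagram d m H) (tq_proj d m H) p q"
proof
  let ?E = "bk_equiv K (tq_diagram d m H) (tq_proj d m H)"
  have nf: "\<exists>\<sigma> c t. ?E r (\<sigma>, (c, t)) \<and> (\<forall>k<length \<sigma>. 0 < t k)"
    if "r \<in> topspace (bk_total K (tq_diagram d m H))" for r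
  proof -
    obtain \<sigma> c t where [simp]: "r = (\<sigma>, (c, t))" by (cases r)
    show ?thesis
      using that bk_normal_form[where P = K and F = "tq_diagram d m H" and f = "tq_proj d m H",
          OF tq_proj_mem_topspace[OF H], of \<sigma> c t] by simp
  qed
  assume eq: "collapse m p = collapse m q"
  obtain \<sigma> c t where 1: "?E p (\<sigma>, (c, t))" "\<And>k. k < length \<sigma> \<Longrightarrow> 0 < t k"
    using nf[OF p] by blast
  obtain \<sigma>' c' t' where 2: "?E q (\<sigma>', (c', t'))" "\<And>k. k < length \<sigma>' \<Longrightarrow> 0 < t' k"
    using nf[OF q] by blast
  have mem: "(\<sigma>, (c, t)) \<in> topspace (bk_total K (tq_diagram d m H))"
    "(\<sigma>', (c', t')) \<in> topspace (bk_total K (tq_diagram d m H))"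
    using 1(1) 2(1) unfolding bk_equiv_def by blast+
  have "collapse m (\<sigma>, (c, t)) = collapse m (\<sigma>', (c', t'))"
    using eq collapse_equiv[OF H 1(1)] collapse_equiv[OF H 2(1)] by simp
  then have "(\<sigma>, (c, t)) = (\<sigma>', (c', t'))"
    using collapse_inj_on_normal_forms[OF H K mem 1(2) 2(2)] by blast
  then show "?E p q"
    using bk_equiv_trans[OF 1(1)] bk_equiv_sym[OF 2(1)] by simp
qed (rule collapse_equiv[OF H])

section \<open>Compactness, continuity and surjectivity for the collapse map\<close>

lemma compact_space_simplex_top: "compact_space (simplex_top n)"
proof -
  \<comment> \<open>The simplex lives in a countable product of lines, so compactness comes from
    Tychonoff for the product of unit intervals.\<close>
  have "compactin (product_topology (\<lambda>_. euclidean) UNIV) (PiE UNIV (\<lambda>_::nat. {0..1::real}))"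
    by (simp add: compactin_PiE)
  then have c: "compact (PiE UNIV (\<lambda>_::nat. {0..1::real}))"
    by (simp add: euclidean_product_topology)
  have "std_simplex n \<subseteq> PiE UNIV (\<lambda>_. {0..1})"
  proof
    fix t assume t: "t \<in> std_simplex n"
    have "t k \<le> 1" for k
    proof (cases "k \<le> n")
      case True
      then have "t k \<le> sum t {..n}" using t by (intro member_le_sum) (auto simp: std_simplex_def)
      then show ?thesis using t by (simp add: std_simplex_def)
    qed (use t in \<open>simp add: std_simplex_def\<close>)
    then show "t \<in> PiE UNIV (\<lambda>_. {0..1})" using t by (auto simp: std_simplex_def)
  qed
  moreover have "closed (std_simplex n)"
    unfolding std_simplex_def
    by (intro closed_Collect_conj closed_Collect_all closed_Collect_imp closed_Collect_le closed_Collect_eq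
        open_Collect_const continuous_intros continuous_on_product_coordinates)
  ultimately have "compact (std_simplex n)"
    using c by (metis compact_Int_closed inf.absorb_iff2)
  then show ?thesis
    unfolding simplex_top_def by (simp add: compact_space_subtopology)
qed

lemma Hausdorff_simplex_top: "Hausdorff_space (simplex_top n)"
  unfolding simplex_top_def by (intro Hausdorff_space_subtopology) simp

text \<open>An index outside the last and largest member is missed by all members and receives the
  total weight 1. The coordinates of norm below 1 hence lie in \<open>last \<sigma>\<close>, a
  face.\<close>

lemma polar_point_mem_moment_angle:
  assumes K: "simplicial_complex_on m K" and \<sigma>: "\<sigma> \<in> chains K"
    and t: "t \<in> std_simplex (length \<sigma> - 1)" and g: "g \<in> Gm d m"
  shows "polar_point m \<sigma> t g \<in> moment_angle d m K"
proof -
  have s: "\<sigma> \<noteq> []" "sorted_wrt (\<subset>) \<sigma>" "set \<sigma> \<subseteq> K" using \<sigma> by (auto simp: chains_def)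
  have t0: "0 \<le> t k" for k using t by (simp add: std_simplex_def)
  have sum: "sum t {..<length \<sigma>} = 1" using std_simplex_sum[OF t] s(1) by simp
  have r: "0 \<le> radius \<sigma> t i" "radius \<sigma> t i \<le> 1" for i
    using radius_nonneg[of \<sigma> t i] radius_le_sum[of \<sigma> t i] t0 sum by auto
  have "i \<in> last \<sigma>" if "radius \<sigma> t i < 1" for i
  proof (rule ccontr)
    assume i: "i \<notin> last \<sigma>"
    have "sorted_wrt (\<subset>) (butlast \<sigma> @ [last \<sigma>])" using s by simp
    then have "S \<subseteq> last \<sigma>" if "S \<in> set (butlast \<sigma> @ [last \<sigma>])" for S
      using that unfolding sorted_wrt_append by auto
    then have "radius \<sigma> t i = 1"
      using i sum s(1) by (subst radius_eq_sum) auto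
    with that show False by simp
  qed
  then have "{i \<in> {1..m}. norm (polar_point m \<sigma> t g i) < 1} \<subseteq> last \<sigma>"
    using norm_polar_point[OF g] r(1) by auto
  moreover have "last \<sigma> \<in> K" using s by auto
  ultimately have "{i \<in> {1..m}. norm (polar_point m \<sigma> t g i) < 1} \<in> K"
    using K by (auto simp: simplicial_complex_on_def)
  moreover have "polar_point m \<sigma> t g \<in> PiE {1..m} (\<lambda>_. Dd d)"
  proof (rule PiE_I)
    fix i assume "i \<in> {1..m}"
    then show "polar_point m \<sigma> t g i \<in> Dd d"
      using g Dd_mult_Gd[OF _ of_real_in_Dd[OF r]] by (auto simp: polar_point_def gmul_def Gm_def PiE_iff)
  qed (auto simp: polar_point_def gmul_def)
  ultimately show ?thesis
    unfolding moment_angle_eq[OF K] by blast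
qed

lemma continuous_map_polar_point:
  "continuous_map (prod_topology (cube_top m) (simplex_top n)) (cube_top m)
     (\<lambda>(g, t). polar_point m \<sigma> t g)"
proof -
  have "continuous_map (simplex_top n) (cube_top m) (\<lambda>t. \<lambda>i\<in>{1..m}. of_real (radius \<sigma> t i))"
  proof -
    have "continuous_on UNIV (\<lambda>t. if i \<in> \<sigma> ! k then 0 else t k :: real)" for i k
      by (cases "i \<in> \<sigma> ! k") (auto intro: continuous_on_product_coordinates)
    then have "continuous_on UNIV (\<lambda>t. complex_of_real (radius \<sigma> t i))" for i
      unfolding radius_def by (intro continuous_intros)
    then have "continuous_map (simplex_top n) euclidean (\<lambda>t. complex_of_real (radius \<sigma> t i))" for i
      unfolding simplex_top_def by (auto intro: continuous_on_subset)
    then show ?thesis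
      unfolding cube_top_def by (auto simp: continuous_map_componentwise)
  qed
  then have "continuous_map (prod_topology (cube_top m) (simplex_top n)) (prod_topology (cube_top m) (cube_top m))
      (\<lambda>p. (fst p, \<lambda>i\<in>{1..m}. of_real (radius \<sigma> (snd p) i)))"
    by (intro continuous_map_pairedI continuous_map_fst 
        continuous_map_compose[OF continuous_map_snd, unfolded o_def])
  from continuous_map_compose[OF this continuous_map_gmul]
  show ?thesis
    by (rule continuous_map_eq) (auto simp: polar_point_def gmul_def)
qed

text \<open>Continuity is clear before passing to cosets. To descend, the product of the coset map
  with the identity of the simplex has to be a quotient map, which holds because the simplex is
  compact Hausdorff and so locally compact.\<close>

lemma continuous_map_collapse:
  assumes K: "simplicial_complex_on m K" and H: "subgroup_of_Gm d m H"
  shows "continuous_map (bk_total K (tq_diagram d m H)) (mac_orbit_space d m K H) (collapse m)"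
  unfolding bk_total_def
proof (rule continuous_map_from_sum_topology)
  fix \<sigma> assume \<sigma>: "\<sigma> \<in> chains K"
  then have s: "\<sigma> \<noteq> []" "sorted_wrt (\<subset>) \<sigma>" by (auto simp: chains_def)
  define G where "G = subtopology (cube_top m) (Gm d m)"
  define S where "S = simplex_top (length \<sigma> - 1)"
  define M where "M = subtopology (cube_top m) (moment_angle d m K)"
  define q where "q = (\<lambda>g. {gmul m g l |l. l \<in> join_subgroup d m (hd \<sigma>) H})"
  have "tq_diagram d m H (hd \<sigma>) = quotient_topology G q"
    by (simp add: tq_diagram_def coset_space_def G_def q_def)
  then have "quotient_map G (tq_diagram d m H (hd \<sigma>)) q"
    using quotient_map_quotient_topology by metis
  then have quot: "quotient_map (prod_topology G S) (prod_topology (tq_diagram d m H (hd \<sigma>)) S) (\<lambda>(g, t). (q g, t))"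
    unfolding S_def
    by (intro quotient_map_prod_left compact_imp_locally_compact_space compact_space_simplex_top
        Hausdorff_simplex_top disjI1)
  have "continuous_map (prod_topology G S) (cube_top m) (\<lambda>(g, t). polar_point m \<sigma> t g)"
  proof -
    have "prod_topology G S = subtopology (prod_topology (cube_top m) S) (Gm d m \<times> UNIV)"
      unfolding G_def by (metis prod_topology_subtopology_eu subtopology_UNIV subtopology_Times)
    then show ?thesis
      unfolding S_def using continuous_map_from_subtopology[OF continuous_map_polar_point] by metis
  qed
  then have "continuous_map (prod_topology G S) M (\<lambda>(g, t). polar_point m \<sigma> t g)"
    unfolding M_def continuous_map_in_subtopology
    using polar_point_mem_moment_angle[OF K \<sigma>]
    by (auto simp: G_def S_def topspace_simplex_top)
  moreover have "continuous_map M (mac_orbit_space d m K H) (\<lambda>z. {gmul m h z |h. h \<in> H})"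
    unfolding mac_orbit_space_def M_def[symmetric]
    by (intro quotient_imp_continuous_map quotient_map_quotient_topology)
  ultimately have "continuous_map (prod_topology G S) (mac_orbit_space d m K H)
      ((\<lambda>z. {gmul m h z |h. h \<in> H}) \<circ> (\<lambda>(g, t). polar_point m \<sigma> t g))"
    by (rule continuous_map_compose)
  then have "continuous_map (prod_topology G S) (mac_orbit_space d m K H)
      ((\<lambda>x. collapse m (\<sigma>, x)) \<circ> (\<lambda>(g, t). (q g, t)))"
  proof (rule continuous_map_eq)
    fix x
    show "((\<lambda>z. {gmul m h z |h. h \<in> H}) \<circ> (\<lambda>(g, t). polar_point m \<sigma> t g)) x =
        ((\<lambda>x. collapse m (\<sigma>, x)) \<circ> (\<lambda>(g, t). (q g, t))) x"
      by (cases x) (simp add: q_def collapse_coset[OF s])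
  qed
  then show "continuous_map (prod_topology (tq_diagram d m H (hd \<sigma>)) (simplex_top (length \<sigma> - 1)))
      (mac_orbit_space d m K H) (\<lambda>x. collapse m (\<sigma>, x))"
    using continuous_compose_quotient_map[OF quot] unfolding S_def by blast
qed

lemma topspace_mac_orbit_space:
  assumes "simplicial_complex_on m K"
  shows "topspace (mac_orbit_space d m K H) = (\<lambda>z. {gmul m h z |h. h \<in> H}) ` moment_angle d m K"
  using compactin_subset_topspace[OF compactin_moment_angle[OF assms]]
  by (simp add: mac_orbit_space_def Int_absorb1)

text \<open>The norms of a point lie in some Kuhn simplex, and the members of its chain are subsets
  of the face where the norms are below 1, hence faces themselves. The phases from
  \<open>Dd_polar\<close> provide the group element.\<close>

lemma collapse_surj:
  assumes K: "simplicial_complex_on m K" and H: "subgroup_of_Gm d m H"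
  shows "collapse m ` topspace (bk_total K (tq_diagram d m H)) = topspace (mac_orbit_space d m K H)"
proof
  show "collapse m ` topspace (bk_total K (tq_diagram d m H)) \<subseteq> topspace (mac_orbit_space d m K H)"
    using continuous_map_image_subset_topspace[OF continuous_map_collapse[OF K H]] .
  show "topspace (mac_orbit_space d m K H) \<subseteq> collapse m ` topspace (bk_total K (tq_diagram d m H))"
  proof
    fix w assume "w \<in> topspace (mac_orbit_space d m K H)"
    then obtain z where z: "z \<in> moment_angle d m K" "w = {gmul m h z |h. h \<in> H}"
      by (auto simp: topspace_mac_orbit_space[OF K])
    then have zD: "z \<in> PiE {1..m} (\<lambda>_. Dd d)" and zK: "{i \<in> {1..m}. norm (z i) < 1} \<in> K"
      by (auto simp only: moment_angle_eq[OF K] mem_Collect_eq)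
    have D: "z i \<in> Dd d" if "i \<in> {1..m}" for i using zD that by (auto simp: PiE_iff)
    obtain \<sigma> t where \<sigma>: "\<sigma> \<noteq> []" "sorted_wrt (\<subset>) \<sigma>"
      "\<And>S. S \<in> set \<sigma> \<Longrightarrow> S \<subseteq> {i \<in> {1..m}. norm (z i) < 1}"
      and t: "t \<in> std_simplex (length \<sigma> - 1)" "\<And>i. i \<in> {1..m} \<Longrightarrow> radius \<sigma> t i = norm (z i)"
      using radius_exists[of "{1..m}" "\<lambda>i. norm (z i)"] Dd_norm_le_1[OF D] by auto
    have "S \<in> K" if "S \<in> set \<sigma>" for S
      using \<sigma>(3)[OF that] zK K unfolding simplicial_complex_on_def by blast
    then have ch: "\<sigma> \<in> chains K"
      using \<sigma>(1,2) by (auto simp: chains_def)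
    have "\<forall>i\<in>{1..m}. \<exists>u. u \<in> Gd d \<and> z i = u * of_real (norm (z i))"
      using D Dd_polar by metis
    then obtain u where u: "\<And>i. i \<in> {1..m} \<Longrightarrow> u i \<in> Gd d \<and> z i = u i * of_real (norm (z i))"
      by metis
    define g where "g = (\<lambda>i\<in>{1..m}. u i)"
    have g: "g \<in> Gm d m" using u by (auto simp: g_def Gm_def)
    have "polar_point m \<sigma> t g = z"
    proof
      fix i
      show "polar_point m \<sigma> t g i = z i"
      proof (cases "i \<in> {1..m}")
        case True
        then show ?thesis using u[OF True] t(2)[OF True] by (simp add: polar_point_def gmul_def g_def)
      next
        case False
        then show ?thesis using zD PiE_arb[OF zD False] by (auto simp: polar_point_def gmul_def)
      qed
    qed
    then have "w = collapse m (\<sigma>, ({gmul m g l |l. l \<in> join_subgroup d m (hd \<sigma>) H}, t))"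
      by (simp add: collapse_coset[OF \<sigma>(1,2)] z(2))
    moreover have "(\<sigma>, ({gmul m g l |l. l \<in> join_subgroup d m (hd \<sigma>) H}, t))
        \<in> topspace (bk_total K (tq_diagram d m H))"
      unfolding mem_topspace_bk_total topspace_tq_diagram using ch t(1) g by blast
    ultimately show "w \<in> collapse m ` topspace (bk_total K (tq_diagram d m H))" by blast
  qed
qed

lemma finite_chains: "finite P \<Longrightarrow> finite (chains P)"
proof -
  assume P: "finite P"
  have "distinct \<sigma>" if "sorted_wrt (\<subset>) \<sigma>" for \<sigma> :: "'a set list"
    using that by (induction \<sigma>) auto
  then have "chains P \<subseteq> {xs. set xs \<subseteq> P \<and> distinct xs}" by (auto simp: chains_def)
  then show ?thesis
    using finite_subset_distinct[OF P] finite_subset by blast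
qed

lemma compact_bk_total:
  assumes "finite K"
  shows "compact_space (bk_total K (tq_diagram d m H))"
proof -
  have "compactin (cube_top m) (Gm d m)"
    unfolding Gm_def by (intro compactin_cube_PiE compact_Gd)
  note c = compact_space_subtopology[OF this, unfolded compact_space_def]
  have "compact_space (tq_diagram d m H I)" for I
    unfolding tq_diagram_def coset_space_def compact_space_def topspace_quotient_topology
    by (rule image_compactin[OF c quotient_imp_continuous_map[OF quotient_map_quotient_topology]])
  then show ?thesis
    unfolding bk_total_def
    by (intro compact_space_sum_topology finite_chains assms)
      (auto simp: compact_space_prod_topology compact_space_simplex_top)
qed

theorem theorem2p14:
  fixes d m :: nat and K :: "nat set set" and H :: "(nat \<Rightarrow> complex) set"
  assumes "d \<in> {1, 2}"
    and "simplicial_complex_on m K"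
    and "closed_subgroup d m H"
  shows "mac_orbit_space d m K H homotopy_equivalent_space
           poset_hocolim K (tq_diagram d m H) (tq_proj d m H)"
proof -
  note H = closed_subgroup_imp_subgroup[OF assms(3)]
  have K: "I \<subseteq> {1..m}" if "I \<in> K" for I
    using assms(2) that by (auto simp: simplicial_complex_on_def)
  have "finite K"
    by (rule finite_subset[of K "Pow {1..m}"]) (use K in auto)
  \<comment> \<open>A continuous surjection from a compact space onto a Hausdorff space is closed
    and therefore a quotient map.\<close>
  then have "quotient_map (bk_total K (tq_diagram d m H)) (mac_orbit_space d m K H) (collapse m)"
    by (intro continuous_imp_quotient_map continuous_map_collapse compact_bk_total
        Hausdorff_mac_orbit_space collapse_surj assms H)
  moreover have "quotient_map (bk_total K (tq_diagram d m H))
      (poset_hocolim K (tq_diagram d m H) (tq_proj d m H))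
      (\<lambda>p. {q. bk_equiv K (tq_diagram d m H) (tq_proj d m H) p q})"
    unfolding poset_hocolim_def by (rule quotient_map_quotient_topology)
  ultimately have "mac_orbit_space d m K H homeomorphic_space
      poset_hocolim K (tq_diagram d m H) (tq_proj d m H)"
    by (rule quotient_maps_same_fibres_imp_homeomorphic_space)
      (simp only: bk_class_eq_iff collapse_eq_iff[OF H K])
  then show ?thesis
    by (rule homeomorphic_imp_homotopy_equivalent_space)
qed

end
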